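(* If all three masses are equal, $m_1=m_2=m_3$, then the Gaussian curvature of the Jacobi-Maupertuis metric $ds_J^2 = U\, ds^2_{shape}$ on the pair of pants is negative everywhere except at the two Lagrange points, where it is zero.
   Context: Three point masses $m_1,m_2,m_3>0$ have positions $x=(x_1,x_2,x_3)$, $x_i\in\mathbb{R}^2$, with center of mass at the origin, $\sum m_i x_i=0$. Put $r_{ij}=|x_i-x_j|$, $U=\sum_{i<j} m_im_j/r_{ij}^2$ (the potential energy is $-U$), and $I=\sum_i m_i|x_i|^2=\sum_{i<j}m_im_jr_{ij}^2/\sum_i m_i$. The mass inner product is $\langle v,w\rangle=\sum_i m_i v_i\cdot w_i$. Shape sphere: the set $\{\sum m_ix_i=0,\ I=1\}$ is a round unit three-sphere for the mass inner product. The rotation group $SO(2)$ of the plane acts on it by isometries, freely, and the quotient is a two-sphere, the shape sphere. Its points are oriented similarity classes of triangles. The metric $ds^2_{shape}$ is the quotient metric, making the projection from the three-sphere a Riemannian submersion; it is a round metric on a sphere of radius $1/2$. The function $U$ restricted to $I=1$ is rotation invariant and so is viewed as a function on the shape sphere, infinite at the three binary collision points ($r_{12}=0$, $r_{23}=0$, $r_{31}=0$). The pair of pants $P$ is the shape sphere minus the three binary collision points. The Jacobi-Maupertuis metric on $P$ is $ds_J^2=U\,ds^2_{shape}$. The two Lagrange points are the points of $P$ representing equilateral triangles ($r_{12}=r_{23}=r_{31}$), one for each orientation. *)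

theory Defs
  imports "HOL-Analysis.Analysis"
begin

section \<open>Curvature of a Riemannian metric in two coordinates\<close>

definition partial :: "2 \<Rightarrow> (real^2 \<Rightarrow> 'b::real_normed_vector) \<Rightarrow> real^2 \<Rightarrow> 'b" where
  "partial i f p = frechet_derivative f (at p) (axis i 1)"

text \<open>The set \<open>V\<close> is meant to be open.\<close>

primrec Ck_on :: "nat \<Rightarrow> (real^2 \<Rightarrow> 'b::real_normed_vector) \<Rightarrow> (real^2) set \<Rightarrow> bool" where
  "Ck_on 0 f V \<longleftrightarrow> continuous_on V f"
| "Ck_on (Suc k) f V \<longleftrightarrow> (\<forall>p\<in>V. f differentiable (at p)) \<and> (\<forall>i. Ck_on k (partial i f) V)"

definition smooth_on :: "(real^2 \<Rightarrow> 'b::real_normed_vector) \<Rightarrow> (real^2) set \<Rightarrow> bool" where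
  "smooth_on f V \<longleftrightarrow> (\<forall>k. Ck_on k f V)"

text \<open>A metric is given by its coefficient matrix \<open>g p $ i $ j\<close>.
  \<open>christoffel g k i j\<close> has upper index \<open>k\<close>, and \<open>riemann g l k i j\<close> is the \<open>l\<close>-th
  component of \<open>R(\<partial>\<^sub>i, \<partial>\<^sub>j) \<partial>\<^sub>k\<close>. With these conventions the Gaussian curvature
  \<open>g(R(\<partial>\<^sub>1, \<partial>\<^sub>2) \<partial>\<^sub>2, \<partial>\<^sub>1) / det g\<close> of the unit sphere is \<open>1\<close>.\<close>

definition christoffel :: "(real^2 \<Rightarrow> real^2^2) \<Rightarrow> 2 \<Rightarrow> 2 \<Rightarrow> 2 \<Rightarrow> real^2 \<Rightarrow> real" where
  "christoffel g k i j p =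
     (\<Sum>l\<in>UNIV. matrix_inv (g p) $ k $ l *
        (partial i (\<lambda>q. g q $ j $ l) p + partial j (\<lambda>q. g q $ i $ l) p
          - partial l (\<lambda>q. g q $ i $ j) p)) / 2"

definition riemann :: "(real^2 \<Rightarrow> real^2^2) \<Rightarrow> 2 \<Rightarrow> 2 \<Rightarrow> 2 \<Rightarrow> 2 \<Rightarrow> real^2 \<Rightarrow> real" where
  "riemann g l k i j p =
     partial i (christoffel g l j k) p - partial j (christoffel g l i k) p
     + (\<Sum>n\<in>UNIV. christoffel g l i n p * christoffel g n j k p
                   - christoffel g l j n p * christoffel g n i k p)"

definition gauss_curvature :: "(real^2 \<Rightarrow> real^2^2) \<Rightarrow> real^2 \<Rightarrow> real" where
  "gauss_curvature g p = (\<Sum>l\<in>UNIV. g p $ 1 $ l * riemann g l 2 1 2 p) / det (g p)"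

section \<open>The planar three-body problem\<close>

text \<open>The plane is \<open>complex\<close>, so that \<open>SO(2)\<close> acts by multiplication with \<open>cis \<theta>\<close>;
  \<open>m $ i\<close> is the mass and \<open>x $ i\<close> the position of body \<open>i\<close>.\<close>

type_synonym config = "complex^3"

definition mass_inner :: "real^3 \<Rightarrow> config \<Rightarrow> config \<Rightarrow> real" where
  "mass_inner m v w = (\<Sum>i\<in>UNIV. m $ i * (v $ i \<bullet> w $ i))"

definition potential :: "real^3 \<Rightarrow> config \<Rightarrow> real" where
  "potential m x = m $ 1 * m $ 2 / (dist (x $ 1) (x $ 2))\<^sup>2
                 + m $ 2 * m $ 3 / (dist (x $ 2) (x $ 3))\<^sup>2
                 + m $ 3 * m $ 1 / (dist (x $ 3) (x $ 1))\<^sup>2"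

definition config_sphere :: "real^3 \<Rightarrow> config set" where
  "config_sphere m = {x. (\<Sum>i\<in>UNIV. m $ i *\<^sub>R x $ i) = 0 \<and> mass_inner m x x = 1}"

definition rotate_config :: "real \<Rightarrow> config \<Rightarrow> config" where
  "rotate_config \<theta> x = (\<chi> i. cis \<theta> * x $ i)"

text \<open>The points of the quotient by \<open>SO(2)\<close> are the orbits.\<close>

definition shape :: "config \<Rightarrow> config set" where
  "shape x = range (\<lambda>\<theta>. rotate_config \<theta> x)"

definition shape_sphere :: "real^3 \<Rightarrow> config set set" where
  "shape_sphere m = shape ` config_sphere m"

definition collision_points :: "real^3 \<Rightarrow> config set set" where
  "collision_points m =
     shape ` {x \<in> config_sphere m. x $ 1 = x $ 2 \<or> x $ 2 = x $ 3 \<or> x $ 3 = x $ 1}"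

definition pair_of_pants :: "real^3 \<Rightarrow> config set set" where
  "pair_of_pants m = shape_sphere m - collision_points m"

definition lagrange_points :: "real^3 \<Rightarrow> config set set" where
  "lagrange_points m = {q \<in> pair_of_pants m.
     \<exists>x\<in>q. dist (x $ 1) (x $ 2) = dist (x $ 2) (x $ 3) \<and>
           dist (x $ 2) (x $ 3) = dist (x $ 3) (x $ 1)}"

section \<open>The Jacobi-Maupertuis metric and its curvature\<close>

text \<open>The fibre of \<^term>\<open>shape\<close> through \<open>x\<close> has tangent vector \<open>\<i> x\<close> at \<open>x\<close>. The quotient metric
  of two vectors \<open>d\<pi>(v)\<close>, \<open>d\<pi>(w)\<close> is the mass inner product of the components of \<open>v\<close>, \<open>w\<close>
  orthogonal to the fibre.\<close>

definition vertical :: "config \<Rightarrow> config" where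
  "vertical x = (\<chi> i. \<i> * x $ i)"

definition horizontal_part :: "real^3 \<Rightarrow> config \<Rightarrow> config \<Rightarrow> config" where
  "horizontal_part m x v =
     v - (mass_inner m v (vertical x) / mass_inner m (vertical x) (vertical x)) *\<^sub>R vertical x"

definition quotient_metric :: "real^3 \<Rightarrow> config \<Rightarrow> config \<Rightarrow> config \<Rightarrow> real" where
  "quotient_metric m x v w = mass_inner m (horizontal_part m x v) (horizontal_part m x w)"

text \<open>A smooth local parametrization \<open>V \<rightarrow> P\<close> of the pair of pants \<open>P\<close> (the inverse of a chart)
  is represented by a smooth lift \<open>\<sigma>\<close> to the three-sphere; on small enough domains every
  parametrization has one, since the projection is a submersion. The last clause says that
  the differential of \<open>shape \<circ> \<sigma>\<close> is injective, the kernel of the differential of the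
  projection being the vertical line.\<close>

definition pants_parametrization :: "real^3 \<Rightarrow> (real^2) set \<Rightarrow> (real^2 \<Rightarrow> config) \<Rightarrow> bool" where
  "pants_parametrization m V \<sigma> \<longleftrightarrow>
     open V \<and> smooth_on \<sigma> V \<and> \<sigma> ` V \<subseteq> config_sphere m \<and>
     (shape \<circ> \<sigma>) ` V \<subseteq> pair_of_pants m \<and> inj_on (shape \<circ> \<sigma>) V \<and>
     (\<forall>p\<in>V. \<forall>w. horizontal_part m (\<sigma> p) (frechet_derivative \<sigma> (at p) w) = 0 \<longrightarrow> w = 0)"

definition jm_metric :: "real^3 \<Rightarrow> (real^2 \<Rightarrow> config) \<Rightarrow> real^2 \<Rightarrow> real^2^2" where
  "jm_metric m \<sigma> p =
     (\<chi> i j. potential m (\<sigma> p) * quotient_metric m (\<sigma> p) (partial i \<sigma> p) (partial j \<sigma> p))"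

text \<open>The first conjunct excludes a vacuous reading of the second one, so that for each \<open>q\<close>
  there is at most one such \<open>K\<close>.\<close>

definition has_jm_curvature :: "real^3 \<Rightarrow> config set \<Rightarrow> real \<Rightarrow> bool" where
  "has_jm_curvature m q K \<longleftrightarrow>
     (\<exists>V \<sigma>. pants_parametrization m V \<sigma> \<and> q \<in> (shape \<circ> \<sigma>) ` V) \<and>
     (\<forall>V \<sigma> p. pants_parametrization m V \<sigma> \<and> p \<in> V \<and> shape (\<sigma> p) = q \<longrightarrow>
        gauss_curvature (jm_metric m \<sigma>) p = K)"

end

theory Submission
  imports Defs
begin

text \<open>
The curvature has a closed form in terms of the squared side lengths \<open>r, s, t\<close> of the triangle. If
\<open>\<mu>\<close> is the common mass, it is
\<open>- 6 / \<mu>\<^sup>4\<close> times \<open>F / (1/r + 1/s + 1/t)\<close>, where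
\<open>F = (r\<^sup>2 + s\<^sup>2 + t\<^sup>2) / (r s + s t + t r)\<^sup>2 - 3 / (r + s + t)\<^sup>2\<close>.
Since \<open>(r + s + t)\<^sup>2 = (r\<^sup>2 + s\<^sup>2 + t\<^sup>2) + 2 (r s + s t + t r)\<close> and
\<open>r\<^sup>2 + s\<^sup>2 + t\<^sup>2 \<ge> r s + s t + t r\<close> with equality only for \<open>r = s = t\<close>, the number \<open>F\<close> is positive
except for equilateral triangles, where it is zero (\<open>curvature_excess_pos\<close>).

The closed form comes from the complex structure. Let \<open>a, b, c\<close> be the sides as complex numbers,
with \<open>a + b + c = 0\<close>, and let \<open>\<theta> = a db - b da\<close>. This form vanishes on infinitesimal rotations and
dilations, and the Gram identity (\<open>gram_identity\<close>) shows that the quotient metric is a constant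
multiple of \<open>\<bar>\<theta>\<bar>\<^sup>2\<close>. So the Jacobi-Maupertuis metric is \<open>E \<bar>\<theta>\<bar>\<^sup>2\<close> with \<open>E\<close> proportional to
\<open>1/\<bar>a\<bar>\<^sup>2 + 1/\<bar>b\<bar>\<^sup>2 + 1/\<bar>c\<bar>\<^sup>2\<close>. For a metric of this kind the Levi-Civita connection is a single
complex one-form \<open>A\<close>, determined by \<open>2 Re A = d log E\<close> and \<open>d\<theta> + A \<and> \<theta> = 0\<close>, and the curvature is
\<open>dA\<close> (the locale \<open>conformal_coframe\<close>). Here \<open>A\<close> is the difference of the forms
\<open>\<partial> log (\<bar>1/a\<bar>\<^sup>2 + \<bar>1/b\<bar>\<^sup>2 + \<bar>1/c\<bar>\<^sup>2)\<close> and \<open>\<partial> log (\<bar>a\<bar>\<^sup>2 + \<bar>b\<bar>\<^sup>2 + \<bar>c\<bar>\<^sup>2)\<close>. By Lagrange's identity the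
differential of such a form is a sum over pairs of Wronskians (\<open>curl_log_form\<close>). The Wronskian of
two consecutive sides \<open>y, z\<close> is \<open>\<theta>\<close>, and that of their reciprocals is \<open>- \<theta> / (y z)\<^sup>2\<close>; this gives the two
terms of \<open>F\<close>.

All of this is carried out along an arbitrary lift to the three-sphere, so no coordinate on the
shape sphere is singled out, both orientations are treated alike, and the independence of the
parametrization is visible from the result: it depends on the side lengths only
(\<open>gauss_curvature_jm_metric\<close>). What remains is that every point of the pair of pants lies in the
image of some parametrization. For this a projective chart centred at the given shape is
normalized to unit size (\<open>parametrization_exists\<close>).
\<close>

section \<open>Partial derivatives\<close>

lemma partial_unique:
  assumes "(f has_derivative f') (at p)"
  shows "partial i f p = f' (axis i 1)"
  unfolding partial_def using frechet_derivative_at[OF assms] by simp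

lemma has_derivative_frechet:
  assumes "f differentiable (at p)"
  shows "(f has_derivative frechet_derivative f (at p)) (at p)"
  using assms frechet_derivative_works by blast

lemma partial_cong_open:
  assumes "open V" "p \<in> V" and eq: "\<And>q. q \<in> V \<Longrightarrow> f q = g q"
  shows "partial i f p = partial i g p"
proof -
  have "(f has_derivative F) (at p) \<longleftrightarrow> (g has_derivative F) (at p)" for F
    using has_derivative_transform_within_open[OF _ assms(1,2), of f F UNIV g]
      has_derivative_transform_within_open[OF _ assms(1,2), of g F UNIV f] eq by auto
  then show ?thesis
    unfolding partial_def frechet_derivative_def by simp
qed

lemma differentiable_cong_open:
  assumes "open V" "p \<in> V" and eq: "\<And>q. q \<in> V \<Longrightarrow> f q = g q"
    and "f differentiable (at p)"
  shows "g differentiable (at p)"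
  using assms(4) has_derivative_transform_within_open[OF _ assms(1,2), of f _ UNIV g] eq
  unfolding differentiable_def by auto

lemma partial_const [simp]: "partial i (\<lambda>q. c) p = 0"
  by (simp add: partial_unique[OF has_derivative_const])

lemma partial_add:
  assumes "f differentiable (at p)" "g differentiable (at p)"
  shows "partial i (\<lambda>q. f q + g q) p = partial i f p + partial i g p"
  unfolding partial_unique[OF has_derivative_add[OF assms[THEN has_derivative_frechet]]]
  by (simp add: partial_def)

lemma partial_diff:
  assumes "f differentiable (at p)" "g differentiable (at p)"
  shows "partial i (\<lambda>q. f q - g q) p = partial i f p - partial i g p"
  unfolding partial_unique[OF has_derivative_diff[OF assms[THEN has_derivative_frechet]]]
  by (simp add: partial_def)

lemma partial_bounded_linear:
  assumes "bounded_linear L" "f differentiable (at p)"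
  shows "partial i (\<lambda>q. L (f q)) p = L (partial i f p)"
  unfolding partial_unique[OF bounded_linear.has_derivative[OF assms(1)
        assms(2)[THEN has_derivative_frechet]]]
  by (simp add: partial_def)

lemmas partial_minus = partial_bounded_linear[OF bounded_linear_minus[OF bounded_linear_ident]]
  and partial_cnj = partial_bounded_linear[OF bounded_linear_cnj]
  and partial_Re = partial_bounded_linear[OF bounded_linear_Re]
  and partial_of_real = partial_bounded_linear[OF bounded_linear_of_real]

lemma partial_mult:
  fixes f g :: "real^2 \<Rightarrow> 'a::real_normed_algebra"
  assumes "f differentiable (at p)" "g differentiable (at p)"
  shows "partial i (\<lambda>q. f q * g q) p = f p * partial i g p + partial i f p * g p"
  unfolding partial_unique[OF has_derivative_mult[OF assms[THEN has_derivative_frechet]]]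
  by (simp add: partial_def)

lemma partial_scaleR:
  assumes "f differentiable (at p)" "g differentiable (at p)"
  shows "partial i (\<lambda>q. f q *\<^sub>R g q) p = f p *\<^sub>R partial i g p + partial i f p *\<^sub>R g p"
  unfolding partial_unique[OF has_derivative_scaleR[OF assms[THEN has_derivative_frechet]]]
  by (simp add: partial_def)

lemma partial_divide:
  fixes f g :: "real^2 \<Rightarrow> 'a::real_normed_field"
  assumes "f differentiable (at p)" "g differentiable (at p)" "g p \<noteq> 0"
  shows "partial i (\<lambda>q. f q / g q) p = (partial i f p * g p - f p * partial i g p) / (g p)\<^sup>2"
  unfolding partial_unique[OF has_derivative_divide'[OF assms(1,2)[THEN has_derivative_frechet] assms(3)]]
  by (simp add: partial_def power2_eq_square)

lemma differentiable_bounded_linear: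
  assumes "bounded_linear L" "f differentiable (at p)"
  shows "(\<lambda>q. L (f q)) differentiable (at p)"
  using bounded_linear.has_derivative[OF assms(1)] assms(2) unfolding differentiable_def by blast

lemmas differentiable_cnj' = differentiable_bounded_linear[OF bounded_linear_cnj]
  and differentiable_Re' = differentiable_bounded_linear[OF bounded_linear_Re]
  and differentiable_Im' = differentiable_bounded_linear[OF bounded_linear_Im]
  and differentiable_of_real' = differentiable_bounded_linear[OF bounded_linear_of_real]

text \<open>The second difference of \<open>f\<close> along \<open>u\<close> and \<open>v\<close> is the increment of
  \<open>s \<mapsto> f (p + s u + t v) - f (p + s u)\<close>, so the mean value inequality compares it with the
  increment of \<open>\<partial>\<^sub>u f\<close> along \<open>t v\<close>.\<close>

lemma second_difference_approximation:
  fixes f :: "'a::real_normed_vector \<Rightarrow> 'b::real_normed_vector"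
  assumes V: "open V" "p \<in> V" and f: "\<And>q. q \<in> V \<Longrightarrow> f differentiable (at q)"
    and D: "((\<lambda>q. frechet_derivative f (at q) u) has_derivative D) (at p)"
    and uv: "norm u = 1" "norm v = 1" and e: "e > 0"
  shows "\<exists>d>0. \<forall>t. 0 < t \<and> t < d \<longrightarrow>
    norm (f (p + t *\<^sub>R u + t *\<^sub>R v) - f (p + t *\<^sub>R u) - f (p + t *\<^sub>R v) + f p - (t * t) *\<^sub>R D v)
      \<le> e * (t * t)"
proof -
  define F where "F q = frechet_derivative f (at q) u" for q
  obtain d0 where d0: "d0 > 0" "ball p d0 \<subseteq> V"
    using V open_contains_ball by blast
  obtain d1 where d1: "d1 > 0" and
    d1': "\<And>q. norm (q - p) < d1 \<Longrightarrow> norm (F q - F p - D (q - p)) \<le> e / 3 * norm (q - p)"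
    using D e unfolding has_derivative_at_alt F_def by (metis divide_pos_pos zero_less_numeral)
  interpret D: bounded_linear D using D by (rule has_derivative_bounded_linear)
  define d where "d = min d0 d1 / 2"
  have "norm (f (p + t *\<^sub>R u + t *\<^sub>R v) - f (p + t *\<^sub>R u) - f (p + t *\<^sub>R v) + f p - (t * t) *\<^sub>R D v)
      \<le> e * (t * t)" if t: "0 < t" "t < d" for t
  proof -
    \<comment> \<open>The term linear in \<open>s\<close> makes the derivative of \<open>\<phi>\<close> small instead of merely close to a constant.\<close>
    define \<phi> where "\<phi> s = f (p + s *\<^sub>R u + t *\<^sub>R v) - f (p + s *\<^sub>R u) - (s * t) *\<^sub>R D v" for s
    define \<phi>' where "\<phi>' s = F (p + s *\<^sub>R u + t *\<^sub>R v) - F (p + s *\<^sub>R u) - t *\<^sub>R D v" for s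
    have small: "norm (s *\<^sub>R u + t *\<^sub>R v) \<le> 2 * t" "norm (s *\<^sub>R u) \<le> t" if "s \<in> {0..t}" for s
      using norm_triangle_ineq[of "s *\<^sub>R u" "t *\<^sub>R v"] uv that t by auto
    have dd: "2 * t < d0" "2 * t < d1" using t unfolding d_def by auto
    have inV: "p + s *\<^sub>R u + t *\<^sub>R v \<in> V" "p + s *\<^sub>R u \<in> V" if "s \<in> {0..t}" for s
    proof -
      have "dist p (p + s *\<^sub>R u + t *\<^sub>R v) = norm (s *\<^sub>R u + t *\<^sub>R v)"
        "dist p (p + s *\<^sub>R u) = norm (s *\<^sub>R u)"
        by (simp_all only: dist_norm norm_minus_commute[of p] add_diff_cancel_left' add.assoc)
      then show "p + s *\<^sub>R u + t *\<^sub>R v \<in> V" "p + s *\<^sub>R u \<in> V"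
        using small[OF that] dd t d0(2) by (auto simp: subset_iff)
    qed
    have der: "(\<phi> has_derivative (\<lambda>h. h *\<^sub>R \<phi>' s)) (at s within {0..t})" if "s \<in> {0..t}" for s
    proof -
      have *: "((\<lambda>s. f (c + s *\<^sub>R u)) has_derivative (\<lambda>h. h *\<^sub>R F (c + s *\<^sub>R u))) (at s)"
        if "c + s *\<^sub>R u \<in> V" for c
      proof -
        have "(f has_derivative frechet_derivative f (at (c + s *\<^sub>R u))) (at (c + s *\<^sub>R u))"
          using f[OF that] frechet_derivative_works by blast
        moreover have "((\<lambda>s. c + s *\<^sub>R u) has_derivative (\<lambda>h. h *\<^sub>R u)) (at s)"
          by (auto intro!: derivative_eq_intros)
        ultimately have "((\<lambda>s. f (c + s *\<^sub>R u)) has_derivative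
            (\<lambda>h. frechet_derivative f (at (c + s *\<^sub>R u)) (h *\<^sub>R u))) (at s)"
          using has_derivative_compose by fast
        then show ?thesis
          using linear_frechet_derivative[OF f[OF that]] unfolding F_def by (simp add: linear_cmul)
      qed
      have 1: "((\<lambda>s. f (p + s *\<^sub>R u + t *\<^sub>R v)) has_derivative
            (\<lambda>h. h *\<^sub>R F (p + s *\<^sub>R u + t *\<^sub>R v))) (at s)"
        using *[of "p + t *\<^sub>R v"] inV[OF that] by (simp add: algebra_simps)
      have 3: "((\<lambda>s. (s * t) *\<^sub>R D v) has_derivative (\<lambda>h. (h * t) *\<^sub>R D v)) (at s)"
        by (auto intro!: derivative_eq_intros)
      have "(\<phi> has_derivative (\<lambda>h. h *\<^sub>R F (p + s *\<^sub>R u + t *\<^sub>R v) - h *\<^sub>R F (p + s *\<^sub>R u)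
          - (h * t) *\<^sub>R D v)) (at s)"
        unfolding \<phi>_def using has_derivative_diff[OF has_derivative_diff[OF 1 *[OF inV(2)[OF that]]] 3] .
      then have "(\<phi> has_derivative (\<lambda>h. h *\<^sub>R \<phi>' s)) (at s)"
        by (rule back_subst) (auto simp: \<phi>'_def algebra_simps)
      then show ?thesis by (rule has_derivative_at_withinI)
    qed
    have bound: "norm (\<phi>' s) \<le> e * t" if s: "s \<in> {0..t}" for s
    proof -
      have "norm (F (p + s *\<^sub>R u + t *\<^sub>R v) - F p - D (s *\<^sub>R u + t *\<^sub>R v)) \<le> e / 3 * (2 * t)"
        using d1'[of "p + s *\<^sub>R u + t *\<^sub>R v"] small[OF s] dd e t
        by (smt (verit) add.assoc add_diff_cancel_left' mult_left_mono zero_le_divide_iff)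
      moreover have "norm (F (p + s *\<^sub>R u) - F p - D (s *\<^sub>R u)) \<le> e / 3 * t"
        using d1'[of "p + s *\<^sub>R u"] small[OF s] dd e t
        by (smt (verit) add_diff_cancel_left' mult_left_mono zero_le_divide_iff)
      moreover have "\<phi>' s = (F (p + s *\<^sub>R u + t *\<^sub>R v) - F p - D (s *\<^sub>R u + t *\<^sub>R v))
          - (F (p + s *\<^sub>R u) - F p - D (s *\<^sub>R u))"
        unfolding \<phi>'_def by (simp add: D.add D.scaleR)
      ultimately have "norm (\<phi>' s) \<le> e / 3 * (2 * t) + e / 3 * t"
        using norm_triangle_ineq4 order_trans add_mono by (smt (verit))
      then show ?thesis by simp
    qed
    have "norm (\<phi> t - \<phi> 0) \<le> e * t * norm (t - 0)"
    proof (rule differentiable_bound[of "{0..t}" \<phi> "\<lambda>s h. h *\<^sub>R \<phi>' s"])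
      fix s assume s: "s \<in> {0..t}"
      show "onorm (\<lambda>h. h *\<^sub>R \<phi>' s) \<le> e * t"
        using bound[OF s] e t by (intro onorm_bound) (auto simp: mult.commute mult_left_mono)
    qed (use der t in auto)
    then show ?thesis
      using t unfolding \<phi>_def by (simp add: algebra_simps)
  qed
  then show ?thesis
    using d0 d1 unfolding d_def by (intro exI[of _ "min d0 d1 / 2"]) auto
qed

text \<open>Both orders of differentiation are limits of the same second difference divided by \<open>t\<^sup>2\<close>, since
the second difference is symmetric in the two directions (Young's theorem).\<close>

lemma partial_commute:
  assumes V: "open V" "p \<in> V" and f: "\<And>q. q \<in> V \<Longrightarrow> f differentiable (at q)"
    and i: "partial i f differentiable (at p)" and j: "partial j f differentiable (at p)"
  shows "partial i (partial j f) p = partial j (partial i f) p"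
proof (rule ccontr)
  let ?u = "axis i 1 :: real^2" and ?v = "axis j 1 :: real^2"
  let ?A = "partial i (partial j f) p" and ?B = "partial j (partial i f) p"
  assume "?A \<noteq> ?B"
  \<comment> \<open>With this \<open>e\<close> the two approximations of the second difference are too close to each other to allow two limits.\<close>
  define e where "e = norm (?A - ?B) / 3"
  have e: "e > 0" using \<open>?A \<noteq> ?B\<close> unfolding e_def by simp
  have Di: "((\<lambda>q. frechet_derivative f (at q) ?u) has_derivative
      frechet_derivative (partial i f) (at p)) (at p)"
    using has_derivative_frechet[OF i] unfolding partial_def[abs_def] .
  have Dj: "((\<lambda>q. frechet_derivative f (at q) ?v) has_derivative
      frechet_derivative (partial j f) (at p)) (at p)"
    using has_derivative_frechet[OF j] unfolding partial_def[abs_def] .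
  obtain d where d: "d > 0" and
    dB: "\<And>t. 0 < t \<Longrightarrow> t < d \<Longrightarrow> norm (f (p + t *\<^sub>R ?u + t *\<^sub>R ?v) - f (p + t *\<^sub>R ?u)
        - f (p + t *\<^sub>R ?v) + f p - (t * t) *\<^sub>R ?B) \<le> e * (t * t)"
    using second_difference_approximation[OF V f Di _ _ e, of ?v] unfolding partial_def
    by (auto simp: norm_axis_1)
  obtain d' where d': "d' > 0" and
    dA: "\<And>t. 0 < t \<Longrightarrow> t < d' \<Longrightarrow> norm (f (p + t *\<^sub>R ?v + t *\<^sub>R ?u) - f (p + t *\<^sub>R ?v)
        - f (p + t *\<^sub>R ?u) + f p - (t * t) *\<^sub>R ?A) \<le> e * (t * t)"
    using second_difference_approximation[OF V f Dj _ _ e, of ?u] unfolding partial_def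
    by (auto simp: norm_axis_1)
  define t where "t = min d d' / 2"
  have t: "t > 0" "t < d" "t < d'" using d d' unfolding t_def by auto
  define X where "X = f (p + t *\<^sub>R ?u + t *\<^sub>R ?v) - f (p + t *\<^sub>R ?u) - f (p + t *\<^sub>R ?v) + f p"
  have "norm (X - (t * t) *\<^sub>R ?B) \<le> e * (t * t)"
    using dB[OF t(1,2)] unfolding X_def .
  moreover have "norm (X - (t * t) *\<^sub>R ?A) \<le> e * (t * t)"
    using dA[OF t(1,3)] unfolding X_def by (simp add: algebra_simps)
  moreover have "norm ((t * t) *\<^sub>R (?A - ?B)) \<le> norm (X - (t * t) *\<^sub>R ?B) + norm (X - (t * t) *\<^sub>R ?A)"
    using norm_triangle_ineq4[of "X - (t * t) *\<^sub>R ?B" "X - (t * t) *\<^sub>R ?A"] by (simp add: algebra_simps)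
  ultimately have "(t * t) * norm (?A - ?B) \<le> 2 * (e * (t * t))" by simp
  also have "\<dots> = (t * t) * (2 * e)" by simp
  finally have "(t * t) * norm (?A - ?B) \<le> (t * t) * (2 * e)" .
  then have "norm (?A - ?B) \<le> 2 * e" using t(1) by simp
  then show False using e unfolding e_def by simp
qed

section \<open>Curvature in terms of a complex coframe\<close>

text \<open>Cramer's rule for the real basis \<open>a, b\<close> of the plane, with the denominator \<open>Im (cnj a * b)\<close>
cleared; that number is the oriented area spanned by \<open>a\<close> and \<open>b\<close>.\<close>

lemma complex_coordinates:
  "complex_of_real (Im (cnj a * b)) * z =
    complex_of_real (Im (cnj z * b)) * a + complex_of_real (Im (cnj a * z)) * b"
  by (simp add: complex_eq_iff algebra_simps)

lemma gram_determinant: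
  "(Re (cnj a * a)) * (Re (cnj b * b)) - Re (cnj a * b) * Re (cnj b * a) = (Im (cnj a * b))\<^sup>2"
  by (simp add: algebra_simps power2_eq_square)

lemma matrix_inv_left:
  fixes M :: "'a::semiring_1^'n^'m"
  assumes "invertible M"
  shows "matrix_inv M ** M = mat 1"
  using someI_ex[OF assms[unfolded invertible_def]] unfolding matrix_inv_def by blast

text \<open>A metric \<open>E \<bar>\<theta>\<bar>\<^sup>2\<close> given by a complex one-form \<open>\<theta>\<close> with components \<open>\<theta> 1\<close>, \<open>\<theta> 2\<close>. The form identifies
each tangent plane with \<open>\<complex>\<close>, and in this identification the Levi-Civita connection is
\<open>\<xi> \<mapsto> d\<xi> + A \<xi>\<close> for a complex one-form \<open>A\<close>: it is compatible with the metric if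
\<open>2 Re A = d log E\<close>, and torsion free if \<open>d\<theta> + A \<and> \<theta> = 0\<close>. As \<open>A\<close> has values in the commutative
algebra \<open>\<complex>\<close>, the curvature is \<open>dA\<close>, without a quadratic term.\<close>

locale conformal_coframe =
  fixes V :: "(real^2) set" and \<theta> A :: "2 \<Rightarrow> real^2 \<Rightarrow> complex"
    and E :: "real^2 \<Rightarrow> real" and g :: "real^2 \<Rightarrow> real^2^2"
  assumes open_V: "open V"
    and \<theta>_diff: "\<And>i q. q \<in> V \<Longrightarrow> \<theta> i differentiable (at q)"
    and \<theta>_diff2: "\<And>i j q. q \<in> V \<Longrightarrow> partial i (\<theta> j) differentiable (at q)"
    and A_diff: "\<And>i q. q \<in> V \<Longrightarrow> A i differentiable (at q)"
    and E_diff: "\<And>q. q \<in> V \<Longrightarrow> E differentiable (at q)"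
    and E_nz: "\<And>q. q \<in> V \<Longrightarrow> E q \<noteq> 0"
    and frame: "\<And>q. q \<in> V \<Longrightarrow> Im (cnj (\<theta> 1 q) * \<theta> 2 q) \<noteq> 0"
    and metric: "\<And>i j q. q \<in> V \<Longrightarrow> g q $ i $ j = E q * Re (cnj (\<theta> i q) * \<theta> j q)"
    and compatible: "\<And>i q. q \<in> V \<Longrightarrow> partial i E q = 2 * Re (A i q) * E q"
    and torsion_free: "\<And>i j q. q \<in> V \<Longrightarrow>
      partial i (\<theta> j) q + A i q * \<theta> j q = partial j (\<theta> i) q + A j q * \<theta> i q"
begin

definition covariant_deriv where "covariant_deriv i j q = partial i (\<theta> j) q + A i q * \<theta> j q"

definition coord :: "2 \<Rightarrow> complex \<Rightarrow> real^2 \<Rightarrow> real" where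
  "coord k z q = (if k = 1 then Im (cnj z * \<theta> 2 q) else Im (cnj (\<theta> 1 q) * z))
     / Im (cnj (\<theta> 1 q) * \<theta> 2 q)"

lemma covariant_deriv_sym: "q \<in> V \<Longrightarrow> covariant_deriv i j q = covariant_deriv j i q"
  using torsion_free unfolding covariant_deriv_def .

lemma coord_expansion:
  assumes "q \<in> V"
  shows "(\<Sum>k\<in>UNIV. complex_of_real (coord k z q) * \<theta> k q) = z"
proof -
  have "(\<Sum>k\<in>UNIV. complex_of_real (coord k z q) * \<theta> k q) =
      (complex_of_real (Im (cnj z * \<theta> 2 q)) * \<theta> 1 q + complex_of_real (Im (cnj (\<theta> 1 q) * z)) * \<theta> 2 q)
      / complex_of_real (Im (cnj (\<theta> 1 q) * \<theta> 2 q))"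
    by (simp only: sum_2 coord_def of_real_divide add_divide_distrib times_divide_eq_left) simp
  also have "\<dots> = z"
    unfolding complex_coordinates[symmetric]
    by (rule nonzero_mult_div_cancel_left) (simp only: of_real_eq_0_iff frame[OF assms] not_False_eq_True)
  finally show ?thesis .
qed

lemma det_metric:
  assumes "q \<in> V"
  shows "det (g q) = (E q)\<^sup>2 * (Im (cnj (\<theta> 1 q) * \<theta> 2 q))\<^sup>2"
  unfolding det_2 metric[OF assms] gram_determinant[symmetric]
  by (simp add: algebra_simps power2_eq_square)

lemma matrix_inv_metric:
  assumes "q \<in> V"
  shows "(\<Sum>l\<in>UNIV. matrix_inv (g q) $ k $ l * (E q * Re (cnj z * \<theta> l q))) = coord k z q"
proof -
  let ?c = "\<chi> n. coord n z q"
  have "(g q *v ?c) $ l = E q * Re (cnj z * \<theta> l q)" for l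
  proof -
    have "Re (cnj z * \<theta> l q) = Re (cnj (\<Sum>k\<in>UNIV. complex_of_real (coord k z q) * \<theta> k q) * \<theta> l q)"
      using coord_expansion[OF assms] by simp
    then show ?thesis
      by (simp add: matrix_vector_mult_def sum_2 metric[OF assms] algebra_simps)
  qed
  moreover have "invertible (g q)"
    using det_metric[OF assms] E_nz[OF assms] frame[OF assms] by (simp add: invertible_det_nz)
  then have "matrix_inv (g q) *v (g q *v ?c) = ?c"
    by (simp add: matrix_vector_mul_assoc matrix_inv_left)
  moreover have "(\<Sum>l\<in>UNIV. matrix_inv (g q) $ k $ l * (g q *v ?c) $ l)
      = (matrix_inv (g q) *v (g q *v ?c)) $ k"
    by (simp only: matrix_vector_mult_def vec_lambda_beta)
  ultimately show ?thesis by simp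
qed

lemma partial_metric:
  assumes "q \<in> V"
  shows "partial i (\<lambda>q. g q $ j $ l) q =
    E q * (Re (cnj (covariant_deriv i j q) * \<theta> l q) + Re (cnj (covariant_deriv i l q) * \<theta> j q))"
proof -
  have "partial i (\<lambda>q. g q $ j $ l) q = partial i (\<lambda>q. E q * Re (cnj (\<theta> j q) * \<theta> l q)) q"
    using metric by (intro partial_cong_open[OF open_V assms]) auto
  also have "\<dots> = E q * Re (cnj (\<theta> j q) * partial i (\<theta> l) q + cnj (partial i (\<theta> j) q) * \<theta> l q)
      + partial i E q * Re (cnj (\<theta> j q) * \<theta> l q)"
    using \<theta>_diff E_diff assms
    by (simp add: partial_mult partial_Re partial_cnj differentiable_mult differentiable_cnj'
        differentiable_Re' del: times_complex.sel)
  also have "\<dots> = E q * (Re (cnj (covariant_deriv i j q) * \<theta> l q) + Re (cnj (covariant_deriv i l q) * \<theta> j q))"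
    unfolding covariant_deriv_def compatible[OF assms] by (simp add: algebra_simps)
  finally show ?thesis .
qed

text \<open>Koszul's formula: by symmetry of the covariant derivative the three derivatives of the metric
combine to \<open>2 E Re (cnj (\<nabla>\<^sub>i \<theta>\<^sub>j) \<theta>\<^sub>l)\<close>.\<close>

lemma christoffel_coord:
  assumes "q \<in> V"
  shows "christoffel g k i j q = coord k (covariant_deriv i j q) q"
proof -
  have "christoffel g k i j q =
      (\<Sum>l\<in>UNIV. matrix_inv (g q) $ k $ l * (E q * Re (cnj (covariant_deriv i j q) * \<theta> l q)))"
    unfolding christoffel_def sum_divide_distrib partial_metric[OF assms]
  proof (intro sum.cong refl)
    fix l
    have "covariant_deriv j i q = covariant_deriv i j q" "covariant_deriv l i q = covariant_deriv i l q" "covariant_deriv l j q = covariant_deriv j l q"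
      using covariant_deriv_sym[OF assms] by blast+
    then show "matrix_inv (g q) $ k $ l *
          (E q * (Re (cnj (covariant_deriv i j q) * \<theta> l q) + Re (cnj (covariant_deriv i l q) * \<theta> j q))
          + E q * (Re (cnj (covariant_deriv j i q) * \<theta> l q) + Re (cnj (covariant_deriv j l q) * \<theta> i q))
          - E q * (Re (cnj (covariant_deriv l i q) * \<theta> j q) + Re (cnj (covariant_deriv l j q) * \<theta> i q))) / 2
        = matrix_inv (g q) $ k $ l * (E q * Re (cnj (covariant_deriv i j q) * \<theta> l q))"
      by (simp add: algebra_simps del: times_complex.sel)
  qed
  then show ?thesis unfolding matrix_inv_metric[OF assms] .
qed

lemma christoffel_expansion:
  assumes "q \<in> V"
  shows "(\<Sum>k\<in>UNIV. complex_of_real (christoffel g k i j q) * \<theta> k q)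
    = partial i (\<theta> j) q + A i q * \<theta> j q"
  unfolding christoffel_coord[OF assms] coord_expansion[OF assms] covariant_deriv_def ..

lemma differentiable_christoffel:
  assumes "q \<in> V"
  shows "christoffel g k i j differentiable (at q)"
proof (rule differentiable_cong_open[OF open_V assms])
  show "coord k (covariant_deriv i j q) q = christoffel g k i j q" if "q \<in> V" for q
    using christoffel_coord[OF that] by simp
  show "(\<lambda>q. coord k (covariant_deriv i j q) q) differentiable (at q)"
    using \<theta>_diff[OF assms] \<theta>_diff2[OF assms] A_diff[OF assms] frame[OF assms]
    unfolding coord_def covariant_deriv_def
    by (cases "k = 1") (auto simp del: times_complex.sel plus_complex.sel intro!: differentiable_divide differentiable_mult
        differentiable_cnj' differentiable_Im' differentiable_add)
qed

text \<open>Differentiating the preceding equation, rather than the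
explicit quotients for the Christoffel symbols, keeps the curvature computation free of
denominators.\<close>

lemma partial_christoffel_expansion:
  assumes "q \<in> V"
  shows "(\<Sum>l\<in>UNIV. complex_of_real (partial i (christoffel g l j k) q) * \<theta> l q
        + complex_of_real (christoffel g l j k q) * partial i (\<theta> l) q)
    = partial i (partial j (\<theta> k)) q + partial i (A j) q * \<theta> k q + A j q * partial i (\<theta> k) q"
proof -
  have "partial i (\<lambda>q. \<Sum>l\<in>UNIV. complex_of_real (christoffel g l j k q) * \<theta> l q) q
      = partial i (\<lambda>q. partial j (\<theta> k) q + A j q * \<theta> k q) q"
    using christoffel_expansion by (intro partial_cong_open[OF open_V assms]) auto
  moreover have "partial i (\<lambda>q. \<Sum>l\<in>UNIV. complex_of_real (christoffel g l j k q) * \<theta> l q) q =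
      (\<Sum>l\<in>UNIV. complex_of_real (partial i (christoffel g l j k) q) * \<theta> l q
        + complex_of_real (christoffel g l j k q) * partial i (\<theta> l) q)"
    using \<theta>_diff[OF assms] differentiable_christoffel[OF assms] unfolding sum_2
    by (simp add: partial_add partial_mult partial_of_real differentiable_add
          differentiable_mult differentiable_of_real')
  moreover have "partial i (\<lambda>q. partial j (\<theta> k) q + A j q * \<theta> k q) q =
      partial i (partial j (\<theta> k)) q + (A j q * partial i (\<theta> k) q + partial i (A j) q * \<theta> k q)"
    using \<theta>_diff[OF assms] \<theta>_diff2[OF assms] A_diff[OF assms]
    by (simp add: partial_add partial_mult differentiable_mult)
  ultimately show ?thesis by simp
qed

text \<open>Antisymmetrizing the derivatives of the Christoffel expansions cancels the second derivatives
of \<open>\<theta>\<close>, and the terms quadratic in \<open>A\<close> cancel because multiplication in \<open>\<complex>\<close> commutes.\<close>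

lemma riemann_expansion:
  assumes "q \<in> V"
  shows "(\<Sum>l\<in>UNIV. complex_of_real (riemann g l k i j q) * \<theta> l q)
    = (partial i (A j) q - partial j (A i) q) * \<theta> k q"
proof -
  have comm: "partial i (partial j (\<theta> k)) q = partial j (partial i (\<theta> k)) q"
    using partial_commute[OF open_V assms \<theta>_diff \<theta>_diff2[OF assms] \<theta>_diff2[OF assms]] .
  let ?\<Gamma> = "\<lambda>l i k. complex_of_real (christoffel g l i k q)"
  have "(\<Sum>l\<in>UNIV. complex_of_real (riemann g l k i j q) * \<theta> l q)
    = (\<Sum>l\<in>UNIV. complex_of_real (partial i (christoffel g l j k) q) * \<theta> l q
          + ?\<Gamma> l j k * partial i (\<theta> l) q)
      - (\<Sum>l\<in>UNIV. complex_of_real (partial j (christoffel g l i k) q) * \<theta> l q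
          + ?\<Gamma> l i k * partial j (\<theta> l) q)
      + (\<Sum>n\<in>UNIV. ?\<Gamma> n j k * ((\<Sum>l\<in>UNIV. ?\<Gamma> l i n * \<theta> l q) - partial i (\<theta> n) q))
      - (\<Sum>n\<in>UNIV. ?\<Gamma> n i k * ((\<Sum>l\<in>UNIV. ?\<Gamma> l j n * \<theta> l q) - partial j (\<theta> n) q))"
    unfolding riemann_def sum_2 by (simp add: algebra_simps)
  also have "\<dots> =
      (partial i (partial j (\<theta> k)) q + partial i (A j) q * \<theta> k q + A j q * partial i (\<theta> k) q)
      - (partial j (partial i (\<theta> k)) q + partial j (A i) q * \<theta> k q + A i q * partial j (\<theta> k) q)
      + (\<Sum>n\<in>UNIV. ?\<Gamma> n j k * (A i q * \<theta> n q)) - (\<Sum>n\<in>UNIV. ?\<Gamma> n i k * (A j q * \<theta> n q))"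
    by (simp only: partial_christoffel_expansion[OF assms] christoffel_expansion[OF assms]
        add_diff_cancel_left')
  also have "\<dots> = (partial i (A j) q - partial j (A i) q) * \<theta> k q
      + A j q * partial i (\<theta> k) q - A i q * partial j (\<theta> k) q
      + A i q * (\<Sum>n\<in>UNIV. ?\<Gamma> n j k * \<theta> n q) - A j q * (\<Sum>n\<in>UNIV. ?\<Gamma> n i k * \<theta> n q)"
    unfolding comm sum_2 by (simp add: algebra_simps)
  also have "\<dots> = (partial i (A j) q - partial j (A i) q) * \<theta> k q"
    unfolding christoffel_expansion[OF assms] by (simp add: algebra_simps)
  finally show ?thesis .
qed

theorem curvature:
  assumes "p \<in> V"
  shows "gauss_curvature g p =
    Re (cnj (\<theta> 1 p) * (partial 1 (A 2) p - partial 2 (A 1) p) * \<theta> 2 p)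
      / (E p * (Im (cnj (\<theta> 1 p) * \<theta> 2 p))\<^sup>2)"
proof -
  have "(\<Sum>l\<in>UNIV. g p $ 1 $ l * riemann g l 2 1 2 p)
      = E p * Re (cnj (\<theta> 1 p) * (\<Sum>l\<in>UNIV. complex_of_real (riemann g l 2 1 2 p) * \<theta> l p))"
    unfolding metric[OF assms] sum_2 by (simp add: algebra_simps)
  also have "\<dots> = E p * Re (cnj (\<theta> 1 p) * (partial 1 (A 2) p - partial 2 (A 1) p) * \<theta> 2 p)"
    unfolding riemann_expansion[OF assms] mult.assoc ..
  finally show ?thesis
    using E_nz[OF assms] unfolding gauss_curvature_def det_metric[OF assms]
    by (simp add: power2_eq_square del: times_complex.sel)
qed

end

section \<open>Logarithmic derivatives of sums of squared moduli\<close>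

definition wronskian :: "(real^2 \<Rightarrow> complex) \<Rightarrow> (real^2 \<Rightarrow> complex) \<Rightarrow> 2 \<Rightarrow> real^2 \<Rightarrow> complex" where
  "wronskian f g i q = f q * partial i g q - g q * partial i f q"

text \<open>Complex-valued, so that differentiation can treat \<open>f\<close> and \<open>cnj f\<close> as separate factors.\<close>

definition norm_square3 ::
    "(real^2 \<Rightarrow> complex) \<Rightarrow> (real^2 \<Rightarrow> complex) \<Rightarrow> (real^2 \<Rightarrow> complex) \<Rightarrow> real^2 \<Rightarrow> complex" where
  "norm_square3 f g h q = f q * cnj (f q) + g q * cnj (g q) + h q * cnj (h q)"

text \<open>For functions \<open>f\<close>, \<open>g\<close>, \<open>h\<close> that depend holomorphically on further variables this is the pullback of
the one-form \<open>\<partial> log (\<bar>f\<bar>\<^sup>2 + \<bar>g\<bar>\<^sup>2 + \<bar>h\<bar>\<^sup>2)\<close>.\<close>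

definition log_form ::
    "(real^2 \<Rightarrow> complex) \<Rightarrow> (real^2 \<Rightarrow> complex) \<Rightarrow> (real^2 \<Rightarrow> complex) \<Rightarrow> 2 \<Rightarrow> real^2 \<Rightarrow> complex"
  where "log_form f g h i q =
    (cnj (f q) * partial i f q + cnj (g q) * partial i g q + cnj (h q) * partial i h q)
      / norm_square3 f g h q"

lemma norm_square3_of_real:
  "norm_square3 f g h q = complex_of_real ((cmod (f q))\<^sup>2 + (cmod (g q))\<^sup>2 + (cmod (h q))\<^sup>2)"
  unfolding norm_square3_def of_real_add complex_norm_square ..

lemma differentiable_log_form:
  assumes "f differentiable (at p)" "g differentiable (at p)" "h differentiable (at p)"
    and "partial i f differentiable (at p)" "partial i g differentiable (at p)"
      "partial i h differentiable (at p)" "norm_square3 f g h p \<noteq> 0"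
  shows "log_form f g h i differentiable (at p)"
  using assms unfolding log_form_def[abs_def] norm_square3_def[abs_def]
  by (intro differentiable_divide differentiable_add differentiable_mult differentiable_cnj')

lemma partial_norm_square3:
  assumes "f differentiable (at p)" "g differentiable (at p)" "h differentiable (at p)"
  shows "partial i (norm_square3 f g h) p =
      f p * cnj (partial i f p) + partial i f p * cnj (f p)
    + g p * cnj (partial i g p) + partial i g p * cnj (g p)
    + h p * cnj (partial i h p) + partial i h p * cnj (h p)"
  using assms unfolding norm_square3_def[abs_def]
  by (simp add: partial_add partial_mult partial_cnj differentiable_add differentiable_mult
      differentiable_cnj')

text \<open>The second derivatives cancel by symmetry. What remains in the numerator is the sum of squares times
the sum of the two-forms \<open>cnj df \<and> df\<close>, minus a product of two sums; Lagrange's identity writes it as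
a sum over the pairs of functions.\<close>

lemma curl_log_form:
  assumes V: "open V" "p \<in> V"
    and d: "\<And>q. q \<in> V \<Longrightarrow> f differentiable (at q)" "\<And>q. q \<in> V \<Longrightarrow> g differentiable (at q)"
      "\<And>q. q \<in> V \<Longrightarrow> h differentiable (at q)"
    and dd: "\<And>i. partial i f differentiable (at p)" "\<And>i. partial i g differentiable (at p)"
      "\<And>i. partial i h differentiable (at p)"
    and nz: "norm_square3 f g h p \<noteq> 0"
  shows "partial i (log_form f g h j) p - partial j (log_form f g h i) p =
    (cnj (wronskian f g i p) * wronskian f g j p - cnj (wronskian f g j p) * wronskian f g i p
     + (cnj (wronskian g h i p) * wronskian g h j p - cnj (wronskian g h j p) * wronskian g h i p)
     + (cnj (wronskian h f i p) * wronskian h f j p - cnj (wronskian h f j p) * wronskian h f i p))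
    / (norm_square3 f g h p)\<^sup>2"
proof -
  let ?N = "norm_square3 f g h"
  let ?Q = "\<lambda>i q. cnj (f q) * partial i f q + cnj (g q) * partial i g q + cnj (h q) * partial i h q"
  note dp = d[OF V(2)]
  have Ndiff: "?N differentiable (at p)"
    unfolding norm_square3_def[abs_def]
    using dp by (intro differentiable_add differentiable_mult differentiable_cnj')
  have Qdiff: "?Q i differentiable (at p)" for i
    using dp dd by (intro differentiable_add differentiable_mult differentiable_cnj')
  have dQ: "partial i (?Q j) p =
      cnj (f p) * partial i (partial j f) p + cnj (partial i f p) * partial j f p
    + (cnj (g p) * partial i (partial j g) p + cnj (partial i g p) * partial j g p)
    + (cnj (h p) * partial i (partial j h) p + cnj (partial i h p) * partial j h p)" for i j
    using dp dd by (simp add: partial_add partial_mult partial_cnj differentiable_add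
        differentiable_mult differentiable_cnj')
  have comm: "partial i (partial j f) p = partial j (partial i f) p"
    "partial i (partial j g) p = partial j (partial i g) p"
    "partial i (partial j h) p = partial j (partial i h) p"
    using partial_commute[OF V d(1) dd(1) dd(1)] partial_commute[OF V d(2) dd(2) dd(2)]
      partial_commute[OF V d(3) dd(3) dd(3)] by auto
  have L: "partial i (log_form f g h j) p =
      (partial i (?Q j) p * ?N p - ?Q j p * partial i ?N p) / (?N p)\<^sup>2" for i j
    unfolding log_form_def[abs_def] using partial_divide[OF Qdiff Ndiff nz] .
  have "partial i (log_form f g h j) p - partial j (log_form f g h i) p =
      ((partial i (?Q j) p - partial j (?Q i) p) * ?N p
        - (?Q j p * partial i ?N p - ?Q i p * partial j ?N p)) / (?N p)\<^sup>2"
    unfolding L by (simp add: diff_divide_distrib add_divide_distrib algebra_simps)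
  also have "(partial i (?Q j) p - partial j (?Q i) p) * ?N p
        - (?Q j p * partial i ?N p - ?Q i p * partial j ?N p) =
    cnj (wronskian f g i p) * wronskian f g j p - cnj (wronskian f g j p) * wronskian f g i p
     + (cnj (wronskian g h i p) * wronskian g h j p - cnj (wronskian g h j p) * wronskian g h i p)
     + (cnj (wronskian h f i p) * wronskian h f j p - cnj (wronskian h f j p) * wronskian h f i p)"
    unfolding dQ partial_norm_square3[OF dp] comm wronskian_def norm_square3_def
      complex_cnj_diff complex_cnj_mult by (simp add: algebra_simps)
  finally show ?thesis .
qed

text \<open>This makes the form compatible with a metric whose conformal factor is the sum of squares.\<close>

lemma Re_log_form:
  assumes "f differentiable (at p)" "g differentiable (at p)" "h differentiable (at p)"
    and "norm_square3 f g h p \<noteq> 0"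
  shows "partial i (\<lambda>q. (cmod (f q))\<^sup>2 + (cmod (g q))\<^sup>2 + (cmod (h q))\<^sup>2) p =
    2 * Re (log_form f g h i p) * ((cmod (f p))\<^sup>2 + (cmod (g p))\<^sup>2 + (cmod (h p))\<^sup>2)"
proof -
  let ?n = "\<lambda>q. (cmod (f q))\<^sup>2 + (cmod (g q))\<^sup>2 + (cmod (h q))\<^sup>2"
  let ?Q = "cnj (f p) * partial i f p + cnj (g p) * partial i g p + cnj (h p) * partial i h p"
  have "?n = (\<lambda>q. Re (norm_square3 f g h q))"
    by (simp add: norm_square3_of_real)
  moreover have "norm_square3 f g h differentiable (at p)"
    unfolding norm_square3_def[abs_def]
    using assms by (intro differentiable_add differentiable_mult differentiable_cnj')
  ultimately have "partial i ?n p = Re (partial i (norm_square3 f g h) p)"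
    by (simp add: partial_Re)
  also have "\<dots> = 2 * Re ?Q"
    unfolding partial_norm_square3[OF assms(1-3)] by simp
  also have "Re ?Q = Re (log_form f g h i p) * ?n p"
    using assms(4) unfolding log_form_def norm_square3_of_real Re_divide_of_real of_real_eq_0_iff
    by (simp only: times_divide_eq_left nonzero_mult_div_cancel_right not_False_eq_True)
  finally show ?thesis by simp
qed

section \<open>Families of triangles of constant size\<close>

text \<open>The sides of a plane triangle, as complex numbers, are \<open>a\<close>, \<open>b\<close> and \<open>c = - (a + b)\<close>. The last
assumption says that the family moves through similarity classes with full rank: \<open>wronskian a b\<close>
vanishes exactly on infinitesimal similarities \<open>da = \<lambda> a\<close>, \<open>db = \<lambda> b\<close>.\<close>

locale triangle_family =
  fixes V :: "(real^2) set" and a b :: "real^2 \<Rightarrow> complex" and S :: real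
  assumes open_V: "open V"
    and diff: "\<And>q. q \<in> V \<Longrightarrow> a differentiable (at q)" "\<And>q. q \<in> V \<Longrightarrow> b differentiable (at q)"
    and diff2: "\<And>i q. q \<in> V \<Longrightarrow> partial i a differentiable (at q)"
      "\<And>i q. q \<in> V \<Longrightarrow> partial i b differentiable (at q)"
    and diff3: "\<And>i j q. q \<in> V \<Longrightarrow> partial i (partial j a) differentiable (at q)"
      "\<And>i j q. q \<in> V \<Longrightarrow> partial i (partial j b) differentiable (at q)"
    and nz: "\<And>q. q \<in> V \<Longrightarrow> a q \<noteq> 0" "\<And>q. q \<in> V \<Longrightarrow> b q \<noteq> 0" "\<And>q. q \<in> V \<Longrightarrow> a q + b q \<noteq> 0"
    and size: "\<And>q. q \<in> V \<Longrightarrow> (cmod (a q))\<^sup>2 + (cmod (b q))\<^sup>2 + (cmod (a q + b q))\<^sup>2 = S"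
    and immersed: "\<And>q. q \<in> V \<Longrightarrow> Im (cnj (wronskian a b 1 q) * wronskian a b 2 q) \<noteq> 0"
begin

definition c where "c q = - (a q + b q)"
definition inv_a where "inv_a q = 1 / a q"
definition inv_b where "inv_b q = 1 / b q"
definition inv_c where "inv_c q = 1 / c q"

definition inverse_square_sum where
  "inverse_square_sum q = 1 / (cmod (a q))\<^sup>2 + 1 / (cmod (b q))\<^sup>2 + 1 / (cmod (a q + b q))\<^sup>2"

text \<open>The metric of interest is proportional to \<open>inverse_square_sum\<close> times the squared modulus of the
one-form \<open>\<theta> = wronskian a b\<close>. Since the sum of the squared sides is constant, the factor may be
divided by that sum, which changes \<open>conn\<close> by a purely imaginary form. The quotient is homogeneous
of degree \<open>-2\<close> in the complex variables \<open>a, b\<close>, and this degree is what makes the connection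
torsion free, because \<open>d\<theta> = 2 da \<and> db\<close>.\<close>

definition conn where "conn i q = log_form inv_a inv_b inv_c i q - log_form a b c i q"

lemma nz_c: "q \<in> V \<Longrightarrow> c q \<noteq> 0"
  unfolding c_def using nz(3) by (metis neg_equal_0_iff_equal)

lemma diff_c: "q \<in> V \<Longrightarrow> c differentiable (at q)"
  unfolding c_def[abs_def] using diff by (intro differentiable_minus differentiable_add)

lemma partial_c:
  assumes "q \<in> V" shows "partial i c q = - (partial i a q + partial i b q)"
  unfolding c_def[abs_def] partial_minus[OF differentiable_add[OF diff[OF assms]]]
    partial_add[OF diff[OF assms]] ..

lemma diff2_c:
  assumes "q \<in> V" shows "partial i c differentiable (at q)"
proof (rule differentiable_cong_open[OF open_V assms])
  show "- (partial i a q + partial i b q) = partial i c q" if "q \<in> V" for q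
    using partial_c[OF that] by simp
  show "(\<lambda>q. - (partial i a q + partial i b q)) differentiable (at q)"
    using diff2[OF assms] by (intro differentiable_minus differentiable_add)
qed

lemma reciprocal:
  fixes f :: "real^2 \<Rightarrow> complex"
  assumes f: "\<And>q. q \<in> V \<Longrightarrow> f differentiable (at q)" "\<And>q. q \<in> V \<Longrightarrow> f q \<noteq> 0"
    and f2: "\<And>q. q \<in> V \<Longrightarrow> partial i f differentiable (at q)" and q: "q \<in> V"
  shows "(\<lambda>q. 1 / f q) differentiable (at q)"
    and "partial i (\<lambda>q. 1 / f q) q = - partial i f q / (f q)\<^sup>2"
    and "partial i (\<lambda>q. 1 / f q) differentiable (at q)"
proof -
  show "(\<lambda>q. 1 / f q) differentiable (at q)"
    by (intro differentiable_divide differentiable_const f q)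
  have *: "partial i (\<lambda>q. 1 / f q) q = - partial i f q / (f q)\<^sup>2" if "q \<in> V" for q
    using f that by (subst partial_divide) auto
  show "partial i (\<lambda>q. 1 / f q) q = - partial i f q / (f q)\<^sup>2" using *[OF q] .
  show "partial i (\<lambda>q. 1 / f q) differentiable (at q)"
  proof (rule differentiable_cong_open[OF open_V q])
    show "- partial i f q / (f q)\<^sup>2 = partial i (\<lambda>q. 1 / f q) q" if "q \<in> V" for q
      using *[OF that] by simp
    show "(\<lambda>q. - partial i f q / (f q)\<^sup>2) differentiable (at q)"
      using f(2)[OF q]
      by (intro differentiable_divide differentiable_minus differentiable_power f f2 q) simp
  qed
qed

lemma inv_a:
  assumes "q \<in> V"
  shows "inv_a differentiable (at q)" "partial i inv_a q = - partial i a q / (a q)\<^sup>2"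
    "partial i inv_a differentiable (at q)"
  unfolding inv_a_def[abs_def] by (rule reciprocal[where i = i]; simp add: diff nz diff2 assms)+

lemma inv_b:
  assumes "q \<in> V"
  shows "inv_b differentiable (at q)" "partial i inv_b q = - partial i b q / (b q)\<^sup>2"
    "partial i inv_b differentiable (at q)"
  unfolding inv_b_def[abs_def] by (rule reciprocal[where i = i]; simp add: diff nz diff2 assms)+

lemma inv_c:
  assumes "q \<in> V"
  shows "inv_c differentiable (at q)" "partial i inv_c q = - partial i c q / (c q)\<^sup>2"
    "partial i inv_c differentiable (at q)"
  unfolding inv_c_def[abs_def]
  by (rule reciprocal[where i = i]; simp add: diff_c nz_c diff2_c assms)+

lemma norm_square3_sides: "q \<in> V \<Longrightarrow> norm_square3 a b c q = complex_of_real S"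
  unfolding norm_square3_of_real c_def norm_minus_cancel using size by simp

lemma norm_square3_reciprocals: "norm_square3 inv_a inv_b inv_c q = complex_of_real (inverse_square_sum q)"
  unfolding norm_square3_of_real inv_a_def inv_b_def inv_c_def c_def inverse_square_sum_def
  by (simp add: norm_divide power_divide del: minus_add_distrib)

lemma inverse_square_sum_pos: "q \<in> V \<Longrightarrow> inverse_square_sum q > 0"
  unfolding inverse_square_sum_def using nz by (simp add: add_pos_pos)

lemma S_pos: "q \<in> V \<Longrightarrow> S > 0"
  using size[of q] nz[of q] by (smt (verit) zero_less_norm_iff zero_less_power zero_le_power2)

lemma norm_square3_nz:
  assumes "q \<in> V"
  shows "norm_square3 a b c q \<noteq> 0" "norm_square3 inv_a inv_b inv_c q \<noteq> 0"
  using S_pos[OF assms] inverse_square_sum_pos[OF assms]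
  unfolding norm_square3_sides[OF assms] norm_square3_reciprocals by auto

text \<open>Because of \<open>a + b + c = 0\<close> a single one-form serves all pairs of sides, so that the sums over pairs
in the differential of \<open>log_form\<close> collapse to multiples of one two-form.\<close>

lemma wronskian_sides:
  assumes "q \<in> V"
  shows "wronskian b c i q = wronskian a b i q" "wronskian c a i q = wronskian a b i q"
  unfolding wronskian_def partial_c[OF assms] c_def by (simp_all add: algebra_simps)

lemma wronskian_reciprocal:
  assumes "x \<noteq> (0::complex)" "y \<noteq> 0"
  shows "1 / x * (- y' / y\<^sup>2) - 1 / y * (- x' / x\<^sup>2) = - (x * y' - y * x') / (x * y)\<^sup>2"
  using assms by (simp add: field_simps power2_eq_square)

lemma wronskian_reciprocals:
  assumes "q \<in> V"
  shows "wronskian inv_a inv_b i q = - wronskian a b i q / (a q * b q)\<^sup>2"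
    "wronskian inv_b inv_c i q = - wronskian a b i q / (b q * c q)\<^sup>2"
    "wronskian inv_c inv_a i q = - wronskian a b i q / (c q * a q)\<^sup>2"
proof -
  show "wronskian inv_a inv_b i q = - wronskian a b i q / (a q * b q)\<^sup>2"
    using wronskian_reciprocal[OF nz(1,2)[OF assms]] unfolding wronskian_def inv_a(2)[OF assms]
      inv_b(2)[OF assms] by (simp only: inv_a_def inv_b_def)
  show "wronskian inv_b inv_c i q = - wronskian a b i q / (b q * c q)\<^sup>2"
    using wronskian_reciprocal[OF nz(2)[OF assms] nz_c[OF assms]]
    unfolding wronskian_sides(1)[OF assms, symmetric] unfolding wronskian_def inv_b(2)[OF assms]
      inv_c(2)[OF assms] by (simp only: inv_b_def inv_c_def)
  show "wronskian inv_c inv_a i q = - wronskian a b i q / (c q * a q)\<^sup>2"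
    using wronskian_reciprocal[OF nz_c[OF assms] nz(1)[OF assms]]
    unfolding wronskian_sides(2)[OF assms, symmetric] unfolding wronskian_def inv_c(2)[OF assms]
      inv_a(2)[OF assms] by (simp only: inv_c_def inv_a_def)
qed

text \<open>The curvature of the connection form as a multiple of the two-form \<open>cnj \<theta> \<and> \<theta>\<close>: the first term
comes from the reciprocals of the sides, the subtracted one from the sides themselves.\<close>

definition excess where
  "excess q = (1 / ((cmod (a q))\<^sup>2 * (cmod (b q))\<^sup>2)\<^sup>2 + 1 / ((cmod (b q))\<^sup>2 * (cmod (a q + b q))\<^sup>2)\<^sup>2
    + 1 / ((cmod (a q + b q))\<^sup>2 * (cmod (a q))\<^sup>2)\<^sup>2) / (inverse_square_sum q)\<^sup>2 - 3 / S\<^sup>2"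

lemma cnj_scaled:
  "cnj (- w / z\<^sup>2) * (- w' / z\<^sup>2) = (cnj w * w') * complex_of_real (1 / ((cmod z)\<^sup>2)\<^sup>2)"
proof -
  have "complex_of_real (((cmod z)\<^sup>2)\<^sup>2) = (z * cnj z)\<^sup>2"
    by (metis complex_norm_square of_real_power)
  then show ?thesis
    by (simp add: power_mult_distrib mult.commute del: of_real_power)
qed

lemma curl_conn:
  assumes "p \<in> V"
  shows "partial i (conn j) p - partial j (conn i) p =
    (cnj (wronskian a b i p) * wronskian a b j p - cnj (wronskian a b j p) * wronskian a b i p)
      * complex_of_real (excess p)"
proof -
  let ?T = "cnj (wronskian a b i p) * wronskian a b j p - cnj (wronskian a b j p) * wronskian a b i p"
  have ca: "cmod (c q) = cmod (a q + b q)" for q unfolding c_def by (rule norm_minus_cancel)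
  have dlog: "log_form inv_a inv_b inv_c i differentiable (at p)" "log_form a b c i differentiable (at p)" for i
    using inv_a(1,3) inv_b(1,3) inv_c(1,3) diff diff2 diff_c diff2_c norm_square3_nz assms
    by (simp_all add: differentiable_log_form)
  have dA: "partial i (conn j) p = partial i (log_form inv_a inv_b inv_c j) p - partial i (log_form a b c j) p" for i j
    unfolding conn_def[abs_def] using partial_diff[OF dlog] .
  let ?t = "\<lambda>f g. cnj (wronskian f g i p) * wronskian f g j p - cnj (wronskian f g j p) * wronskian f g i p"
  have "partial i (log_form a b c j) p - partial j (log_form a b c i) p
      = (?t a b + ?t b c + ?t c a) / (norm_square3 a b c p)\<^sup>2"
    by (rule curl_log_form[OF open_V assms])
      (use assms in \<open>simp_all add: diff diff2 diff_c diff2_c norm_square3_nz\<close>)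
  then have 1: "partial i (log_form a b c j) p - partial j (log_form a b c i) p
      = ?T * complex_of_real (3 / S\<^sup>2)"
    unfolding wronskian_sides[OF assms] norm_square3_sides[OF assms] by simp
  have factor: "(X * complex_of_real \<alpha> - Y * complex_of_real \<alpha>
        + (X * complex_of_real \<beta> - Y * complex_of_real \<beta>)
        + (X * complex_of_real \<gamma> - Y * complex_of_real \<gamma>)) / (complex_of_real n)\<^sup>2
      = (X - Y) * complex_of_real ((\<alpha> + \<beta> + \<gamma>) / n\<^sup>2)" for X Y \<alpha> \<beta> \<gamma> n
    by (simp add: algebra_simps)
  have "partial i (log_form inv_a inv_b inv_c j) p - partial j (log_form inv_a inv_b inv_c i) p
      = (?t inv_a inv_b + ?t inv_b inv_c + ?t inv_c inv_a) / (norm_square3 inv_a inv_b inv_c p)\<^sup>2"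
    by (rule curl_log_form[OF open_V assms])
      (use assms in \<open>simp_all add: inv_a(1,3) inv_b(1,3) inv_c(1,3) norm_square3_nz\<close>)
  also have "\<dots> = ?T * complex_of_real (excess p + 3 / S\<^sup>2)"
    unfolding wronskian_reciprocals[OF assms] norm_square3_reciprocals cnj_scaled factor
    unfolding excess_def norm_mult ca power_mult_distrib diff_add_cancel ..
  finally have 2: "partial i (log_form inv_a inv_b inv_c j) p - partial j (log_form inv_a inv_b inv_c i) p
      = ?T * complex_of_real (excess p + 3 / S\<^sup>2)" .
  have "partial i (conn j) p - partial j (conn i) p
      = ?T * complex_of_real (excess p + 3 / S\<^sup>2) - ?T * complex_of_real (3 / S\<^sup>2)"
    unfolding dA 1[symmetric] 2[symmetric] by simp
  then show ?thesis
    unfolding right_diff_distrib[symmetric] of_real_diff[symmetric] add_diff_cancel_right' .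
qed

text \<open>All pairs of Wronskians are multiples of \<open>\<theta> = wronskian a b\<close>, so only torsion-freeness needs
an idea. By Pluecker's relation, \<open>dy \<and> \<theta> = y da \<and> db\<close> for every side \<open>y\<close>. Hence the form of the
sides contributes \<open>da \<and> db\<close> and the form of their reciprocals, with \<open>d(1/y) = - dy / y\<^sup>2\<close>,
contributes \<open>- da \<and> db\<close>; the difference cancels \<open>d\<theta> = 2 da \<and> db\<close>.\<close>

lemma coframe:
  assumes "\<kappa> \<noteq> 0"
    and g: "\<And>i j q. q \<in> V \<Longrightarrow>
      g q $ i $ j = \<kappa> * inverse_square_sum q * Re (cnj (wronskian a b i q) * wronskian a b j q)"
  shows "conformal_coframe V (wronskian a b) conn (\<lambda>q. \<kappa> * inverse_square_sum q) g"
proof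
  have dw: "partial i (wronskian a b j) q = a q * partial i (partial j b) q
      + partial i a q * partial j b q - (b q * partial i (partial j a) q + partial i b q * partial j a q)"
    if "q \<in> V" for i j q
    using diff[OF that] diff2[OF that] unfolding wronskian_def[abs_def]
    by (simp add: partial_diff partial_mult differentiable_mult)
  have N_eq: "inverse_square_sum = (\<lambda>q. (cmod (inv_a q))\<^sup>2 + (cmod (inv_b q))\<^sup>2 + (cmod (inv_c q))\<^sup>2)"
    unfolding inverse_square_sum_def inv_a_def inv_b_def inv_c_def c_def
    by (simp add: norm_divide power_divide fun_eq_iff del: minus_add_distrib)
  have N_eq2: "inverse_square_sum = (\<lambda>q. Re (norm_square3 inv_a inv_b inv_c q))"
    unfolding norm_square3_reciprocals by simp
  fix i j q assume q: "q \<in> V"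
  show "wronskian a b i differentiable (at q)"
    unfolding wronskian_def[abs_def] using diff[OF q] diff2[OF q]
    by (intro differentiable_diff differentiable_mult)
  show "partial i (wronskian a b j) differentiable (at q)"
  proof (rule differentiable_cong_open[OF open_V q])
    show "a q * partial i (partial j b) q
      + partial i a q * partial j b q - (b q * partial i (partial j a) q + partial i b q * partial j a q)
      = partial i (wronskian a b j) q" if "q \<in> V" for q
      using dw[OF that] by simp
  qed (use diff[OF q] diff2[OF q] diff3[OF q] in
      \<open>intro differentiable_diff differentiable_add differentiable_mult\<close>)
  show "conn i differentiable (at q)"
    unfolding conn_def[abs_def]
    using inv_a(1,3) inv_b(1,3) inv_c(1,3) diff diff2 diff_c diff2_c norm_square3_nz q
    by (simp add: differentiable_log_form differentiable_diff)
  have Nd: "inverse_square_sum differentiable (at q)"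
    unfolding N_eq2 norm_square3_def using inv_a(1) inv_b(1) inv_c(1) q
    by (intro differentiable_Re' differentiable_add differentiable_mult differentiable_cnj') auto
  then show "(\<lambda>q. \<kappa> * inverse_square_sum q) differentiable (at q)"
    by (intro differentiable_mult differentiable_const)
  show "\<kappa> * inverse_square_sum q \<noteq> 0" using assms(1) inverse_square_sum_pos[OF q] by simp
  \<comment> \<open>The size is constant, so dividing by it does not affect compatibility with the metric.\<close>
  have "Re (log_form a b c i q) = 0"
  proof -
    have "partial i (\<lambda>q. (cmod (a q))\<^sup>2 + (cmod (b q))\<^sup>2 + (cmod (c q))\<^sup>2) q = partial i (\<lambda>q. S) q"
      using size by (intro partial_cong_open[OF open_V q]) (simp only: c_def norm_minus_cancel)
    then show ?thesis
      using Re_log_form[OF diff[OF q] diff_c[OF q] norm_square3_nz(1)[OF q], of i]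
        norm_square3_nz(1)[OF q, unfolded norm_square3_of_real of_real_eq_0_iff] by simp
  qed
  then show "partial i (\<lambda>q. \<kappa> * inverse_square_sum q) q = 2 * Re (conn i q) * (\<kappa> * inverse_square_sum q)"
    using Re_log_form[OF inv_a(1)[OF q] inv_b(1)[OF q] inv_c(1)[OF q] norm_square3_nz(2)[OF q], of i]
      fun_cong[OF N_eq, of q] unfolding N_eq[symmetric] conn_def by (simp add: partial_mult Nd)
  let ?P = "partial i a q * partial j b q - partial j a q * partial i b q"
  have pluecker: "partial i y q * wronskian a b j q - partial j y q * wronskian a b i q = y q * ?P"
    if "y \<in> {a, b, c}" for y
    using that q unfolding wronskian_def by (auto simp: partial_c c_def algebra_simps)
  have "log_form a b c i q * wronskian a b j q - log_form a b c j q * wronskian a b i q =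
     (cnj (a q) * (partial i a q * wronskian a b j q - partial j a q * wronskian a b i q)
    + cnj (b q) * (partial i b q * wronskian a b j q - partial j b q * wronskian a b i q)
    + cnj (c q) * (partial i c q * wronskian a b j q - partial j c q * wronskian a b i q))
    / norm_square3 a b c q"
    unfolding log_form_def times_divide_eq_left diff_divide_distrib[symmetric]
    by (intro arg_cong2[where f = divide]) (simp_all add: algebra_simps)
  also have "\<dots> = ?P * (norm_square3 a b c q / norm_square3 a b c q)"
    unfolding pluecker[OF insertI1] pluecker[OF insertI2[OF insertI1]]
      pluecker[OF insertI2[OF insertI2[OF insertI1]]] times_divide_eq_right
    by (intro arg_cong2[where f = divide]) (simp_all add: norm_square3_def algebra_simps)
  finally have t1: "log_form a b c i q * wronskian a b j q - log_form a b c j q * wronskian a b i q = ?P"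
    using norm_square3_nz(1)[OF q] by simp
  have "log_form inv_a inv_b inv_c i q * wronskian a b j q - log_form inv_a inv_b inv_c j q * wronskian a b i q =
     (- cnj (inv_a q) / (a q)\<^sup>2 * (partial i a q * wronskian a b j q - partial j a q * wronskian a b i q)
      - cnj (inv_b q) / (b q)\<^sup>2 * (partial i b q * wronskian a b j q - partial j b q * wronskian a b i q)
      - cnj (inv_c q) / (c q)\<^sup>2 * (partial i c q * wronskian a b j q - partial j c q * wronskian a b i q))
    / norm_square3 inv_a inv_b inv_c q"
    unfolding log_form_def times_divide_eq_left[of _ "norm_square3 inv_a inv_b inv_c q"]
      diff_divide_distrib[of _ _ "norm_square3 inv_a inv_b inv_c q", symmetric]
      inv_a(2)[OF q] inv_b(2)[OF q] inv_c(2)[OF q]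
    by (intro arg_cong2[where f = divide]) (simp_all add: algebra_simps diff_divide_distrib add_divide_distrib)
  also have "\<dots> = - ?P * (norm_square3 inv_a inv_b inv_c q / norm_square3 inv_a inv_b inv_c q)"
    unfolding pluecker[OF insertI1] pluecker[OF insertI2[OF insertI1]]
      pluecker[OF insertI2[OF insertI2[OF insertI1]]] times_divide_eq_right[of _ _ "norm_square3 inv_a inv_b inv_c q"]
  proof (intro arg_cong2[where f = divide] refl)
    have *: "- cnj z / y\<^sup>2 * (y * ?P) = - ?P * (1 / y * cnj z)" for y z :: complex
      by (cases "y = 0") (simp_all add: power2_eq_square field_simps)
    have **: "cnj z / y\<^sup>2 * (y * ?P) = ?P * (1 / y * cnj z)" for y z :: complex
      by (simp add: power2_eq_square)
    show "- cnj (inv_a q) / (a q)\<^sup>2 * (a q * ?P) - cnj (inv_b q) / (b q)\<^sup>2 * (b q * ?P)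
        - cnj (inv_c q) / (c q)\<^sup>2 * (c q * ?P) = - ?P * norm_square3 inv_a inv_b inv_c q"
      unfolding * ** norm_square3_def inv_a_def[of q, symmetric] inv_b_def[of q, symmetric]
        inv_c_def[of q, symmetric] by (simp add: algebra_simps)
  qed
  finally have t2: "log_form inv_a inv_b inv_c i q * wronskian a b j q
      - log_form inv_a inv_b inv_c j q * wronskian a b i q = - ?P"
    using norm_square3_nz(2)[OF q] by simp
  have comm: "partial i (partial j a) q = partial j (partial i a) q"
    "partial i (partial j b) q = partial j (partial i b) q"
    using partial_commute[OF open_V q diff(1) diff2(1)[OF q] diff2(1)[OF q]]
      partial_commute[OF open_V q diff(2) diff2(2)[OF q] diff2(2)[OF q]] by auto
  show "partial i (wronskian a b j) q + conn i q * wronskian a b j q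
      = partial j (wronskian a b i) q + conn j q * wronskian a b i q"
  proof -
    have "conn i q * wronskian a b j q - conn j q * wronskian a b i q =
        (log_form inv_a inv_b inv_c i q * wronskian a b j q - log_form inv_a inv_b inv_c j q * wronskian a b i q)
      - (log_form a b c i q * wronskian a b j q - log_form a b c j q * wronskian a b i q)"
      unfolding conn_def by (simp add: algebra_simps)
    then have "conn i q * wronskian a b j q - conn j q * wronskian a b i q = - 2 * ?P"
      unfolding t1 t2 by simp
    moreover have "partial i (wronskian a b j) q - partial j (wronskian a b i) q = 2 * ?P"
      unfolding dw[OF q] comm by (simp add: algebra_simps)
    ultimately have "(partial i (wronskian a b j) q - partial j (wronskian a b i) q)
        + (conn i q * wronskian a b j q - conn j q * wronskian a b i q) = 0"
      by simp
    then show ?thesis by (simp add: algebra_simps)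
  qed
qed (use open_V immersed g in auto)

theorem triangle_curvature:
  assumes "\<kappa> \<noteq> 0"
    and "\<And>i j q. q \<in> V \<Longrightarrow>
      g q $ i $ j = \<kappa> * inverse_square_sum q * Re (cnj (wronskian a b i q) * wronskian a b j q)"
    and p: "p \<in> V"
  shows "gauss_curvature g p = - 2 * excess p / (\<kappa> * inverse_square_sum p)"
proof -
  interpret conformal_coframe V "wronskian a b" conn "\<lambda>q. \<kappa> * inverse_square_sum q" g
    using coframe[OF assms(1,2)] .
  define T where "T = cnj (wronskian a b 1 p) * wronskian a b 2 p"
  have "cnj (wronskian a b 1 p) * (partial 1 (conn 2) p - partial 2 (conn 1) p) * wronskian a b 2 p
      = T * (T - cnj T) * complex_of_real (excess p)"
    unfolding curl_conn[OF p] T_def by simp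
  then have "Re (cnj (wronskian a b 1 p) * (partial 1 (conn 2) p - partial 2 (conn 1) p)
      * wronskian a b 2 p) = - 2 * excess p * (Im T)\<^sup>2"
    by (simp only:) (simp add: power2_eq_square)
  moreover have "Im T \<noteq> 0" using immersed[OF p] unfolding T_def .
  ultimately show ?thesis
    unfolding curvature[OF p] T_def[symmetric] by simp
qed

end

section \<open>The sign of the curvature\<close>

definition curvature_excess :: "real \<Rightarrow> real \<Rightarrow> real \<Rightarrow> real" where
  "curvature_excess r s t = (1 / (r * s)\<^sup>2 + 1 / (s * t)\<^sup>2 + 1 / (t * r)\<^sup>2) / (1 / r + 1 / s + 1 / t)\<^sup>2
    - 3 / (r + s + t)\<^sup>2"

lemma curvature_excess_alt:
  assumes "r > 0" "s > 0" "t > 0"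
  shows "curvature_excess r s t =
    (r\<^sup>2 + s\<^sup>2 + t\<^sup>2) / (r * s + s * t + t * r)\<^sup>2 - 3 / (r + s + t)\<^sup>2"
proof -
  have "1 / (r * s)\<^sup>2 + 1 / (s * t)\<^sup>2 + 1 / (t * r)\<^sup>2 = (r\<^sup>2 + s\<^sup>2 + t\<^sup>2) / (r * s * t)\<^sup>2"
    using assms by (simp add: field_simps power2_eq_square)
  moreover have "1 / r + 1 / s + 1 / t = (r * s + s * t + t * r) / (r * s * t)"
    using assms by (simp add: field_simps)
  ultimately show ?thesis
    using assms unfolding curvature_excess_def by (simp add: power_divide)
qed

text \<open>With \<open>p\<close> the sum of the squares and \<open>e\<close> the sum of the products of pairs, \<open>(r + s + t)\<^sup>2 = p + 2 e\<close>.
So the claim is \<open>p (p + 2 e) > 3 e\<^sup>2\<close>, that is \<open>(p - e) (p + 3 e) > 0\<close>, and \<open>p > e\<close> unless the three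
numbers agree.\<close>

lemma curvature_excess_pos:
  assumes "r > 0" "s > 0" "t > 0" and "\<not> (r = s \<and> s = t)"
  shows "curvature_excess r s t > 0"
proof -
  define p where "p = r\<^sup>2 + s\<^sup>2 + t\<^sup>2"
  define e where "e = r * s + s * t + t * r"
  have e: "e > 0" using assms unfolding e_def by (simp add: add_pos_pos)
  have "2 * (p - e) = (r - s)\<^sup>2 + (s - t)\<^sup>2 + (t - r)\<^sup>2"
    unfolding p_def e_def by (simp add: power2_eq_square algebra_simps)
  moreover have "(r - s)\<^sup>2 + (s - t)\<^sup>2 + (t - r)\<^sup>2 > 0"
  proof (cases "r = s")
    case False
    then have "(r - s)\<^sup>2 > 0" by simp
    then show ?thesis by (simp add: add_pos_nonneg)
  next
    case True
    then have "(s - t)\<^sup>2 > 0" using assms(4) by simp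
    then show ?thesis by (simp add: add_pos_nonneg add_nonneg_pos)
  qed
  ultimately have "0 < 2 * (p - e)" by (simp only:)
  then have "p > e" by simp
  then have "(p - e) * (p + 3 * e) > 0" using e by (intro mult_pos_pos) auto
  then have "3 * e\<^sup>2 < p * (p + 2 * e)" by (simp add: power2_eq_square algebra_simps)
  moreover have "(r + s + t)\<^sup>2 = p + 2 * e"
    unfolding p_def e_def by (simp add: power2_eq_square algebra_simps)
  ultimately have "3 / (r + s + t)\<^sup>2 < p / e\<^sup>2"
    using e \<open>p > e\<close> by (simp add: field_simps)
  then show ?thesis
    unfolding curvature_excess_alt[OF assms(1-3)] p_def e_def by simp
qed

lemma curvature_excess_equilateral:
  assumes "r > 0"
  shows "curvature_excess r r r = 0"
  using assms unfolding curvature_excess_alt[OF assms assms assms]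
  by (simp add: field_simps power2_eq_square)

section \<open>The quotient metric for equal masses\<close>

text \<open>On configurations with \<open>x $ 1 + x $ 2 + x $ 3 = 0\<close>, a complex plane, this is the complex area
form; \<open>cross x v\<close> vanishes for \<open>x \<noteq> 0\<close> exactly if \<open>v\<close> is a complex multiple of \<open>x\<close>.\<close>

definition cross :: "config \<Rightarrow> config \<Rightarrow> complex" where
  "cross x v = x $ 1 * v $ 2 - x $ 2 * v $ 1"

lemma cross_linear:
  "cross x (v + w) = cross x v + cross x w" "cross x (r *\<^sub>R v) = r *\<^sub>R cross x v"
  "cross (r *\<^sub>R x) v = r *\<^sub>R cross x v" "cross (x + y) v = cross x v + cross y v"
  "cross x (vertical v) = \<i> * cross x v" "cross x x = 0"
  unfolding cross_def vertical_def by (simp_all add: algebra_simps)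

lemma mass_inner_bilinear:
  "mass_inner m (v + w) z = mass_inner m v z + mass_inner m w z"
  "mass_inner m z (v + w) = mass_inner m z v + mass_inner m z w"
  "mass_inner m (v - w) z = mass_inner m v z - mass_inner m w z"
  "mass_inner m z (v - w) = mass_inner m z v - mass_inner m z w"
  "mass_inner m (r *\<^sub>R v) z = r * mass_inner m v z"
  "mass_inner m z (r *\<^sub>R v) = r * mass_inner m z v"
  unfolding mass_inner_def sum_3 by (simp_all add: inner_simps algebra_simps)

lemma mass_inner_commute: "mass_inner m v w = mass_inner m w v"
  unfolding mass_inner_def by (simp add: inner_commute)

lemma mass_inner_vertical: "mass_inner m (vertical v) (vertical w) = mass_inner m v w"
  unfolding mass_inner_def vertical_def by (simp add: inner_complex_def add.commute)

lemma third_component: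
  fixes x y z :: "'a::ab_group_add"
  assumes "x + y + z = 0"
  shows "z = - x - y"
  using assms by (metis add.commute diff_conv_add_uminus eq_neg_iff_add_eq_0 minus_add_distrib)

locale equal_masses =
  fixes m :: "real^3" and \<mu> :: real
  assumes mass: "\<And>i. m $ i = \<mu>" and mass_pos: "\<mu> > 0"
begin

lemma config_sphere_iff:
  "x \<in> config_sphere m \<longleftrightarrow> x $ 1 + x $ 2 + x $ 3 = 0 \<and> mass_inner m x x = 1"
proof -
  have "(\<Sum>i\<in>UNIV. m $ i *\<^sub>R x $ i) = \<mu> *\<^sub>R (x $ 1 + x $ 2 + x $ 3)"
    unfolding sum_3 mass by (simp add: scaleR_add_right)
  then show ?thesis unfolding config_sphere_def using mass_pos by simp
qed

lemma mass_inner_eq_0_iff: "mass_inner m v v = 0 \<longleftrightarrow> v = 0"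
proof
  assume "mass_inner m v v = 0"
  then have "(v $ 1 \<bullet> v $ 1) + (v $ 2 \<bullet> v $ 2) + (v $ 3 \<bullet> v $ 3) = 0"
    using mass_pos unfolding mass_inner_def sum_3 mass by (simp flip: distrib_left)
  then have "v $ 1 = 0" "v $ 2 = 0" "v $ 3 = 0"
    by (smt (verit) inner_ge_zero inner_eq_zero_iff)+
  then show "v = 0" by (simp add: vec_eq_iff forall_3)
qed (simp add: mass_inner_def)

text \<open>The Gram identity for the Hermitian form whose real part is the mass inner product. The
vertical direction contributes the imaginary part of the Hermitian product with \<open>x\<close>; the
factor \<open>3\<close> is the determinant of \<open>\<bar>x\<^sub>1\<bar>\<^sup>2 + \<bar>x\<^sub>2\<bar>\<^sup>2 + \<bar>x\<^sub>1 + x\<^sub>2\<bar>\<^sup>2\<close> as a Hermitian form in \<open>x\<^sub>1, x\<^sub>2\<close>.\<close>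

lemma gram_identity:
  assumes "x $ 1 + x $ 2 + x $ 3 = 0" "v $ 1 + v $ 2 + v $ 3 = 0" "w $ 1 + w $ 2 + w $ 3 = 0"
  shows "mass_inner m x x * mass_inner m v w
      - mass_inner m v (vertical x) * mass_inner m w (vertical x)
      - mass_inner m v x * mass_inner m w x
    = 3 * \<mu>\<^sup>2 * Re (cnj (cross x v) * cross x w)"
proof -
  define P where "P u v = u $ 1 \<bullet> v $ 1 + u $ 2 \<bullet> v $ 2 + u $ 3 \<bullet> v $ 3" for u v :: config
  have P: "mass_inner m u v = \<mu> * P u v" for u v
    unfolding mass_inner_def P_def sum_3 mass by (simp add: algebra_simps)
  note third = assms[THEN third_component]
  have "P x x * P v w - P v (vertical x) * P w (vertical x) - P v x * P w x
      = 3 * Re (cnj (cross x v) * cross x w)"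
    unfolding P_def vertical_def cross_def vec_lambda_beta third
    by (simp add: inner_complex_def algebra_simps)
  then have "\<mu>\<^sup>2 * (P x x * P v w - P v (vertical x) * P w (vertical x) - P v x * P w x)
      = \<mu>\<^sup>2 * (3 * Re (cnj (cross x v) * cross x w))"
    by (simp only:)
  then show ?thesis
    unfolding P by (simp add: power2_eq_square algebra_simps del: times_complex.sel)
qed

lemma quotient_metric_cross:
  assumes x: "x \<in> config_sphere m"
    and v: "v $ 1 + v $ 2 + v $ 3 = 0" "mass_inner m v x = 0"
    and w: "w $ 1 + w $ 2 + w $ 3 = 0" "mass_inner m w x = 0"
  shows "quotient_metric m x v w = 3 * \<mu>\<^sup>2 * Re (cnj (cross x v) * cross x w)"
proof -
  have x': "x $ 1 + x $ 2 + x $ 3 = 0" "mass_inner m x x = 1"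
    using x unfolding config_sphere_iff by auto
  have "quotient_metric m x v w =
      mass_inner m v w - mass_inner m v (vertical x) * mass_inner m w (vertical x)"
    unfolding quotient_metric_def horizontal_part_def mass_inner_vertical x' mass_inner_bilinear
    by (simp add: mass_inner_commute[of m "vertical x"])
  then show ?thesis
    using gram_identity[OF x'(1) v(1) w(1)] v(2) w(2) x'(2) by simp
qed

lemma horizontal_part_eq_0_iff:
  assumes "x \<in> config_sphere m" "v $ 1 + v $ 2 + v $ 3 = 0" "mass_inner m v x = 0"
  shows "horizontal_part m x v = 0 \<longleftrightarrow> cross x v = 0"
proof -
  have "horizontal_part m x v = 0 \<longleftrightarrow> quotient_metric m x v v = 0"
    unfolding quotient_metric_def mass_inner_eq_0_iff ..
  also have "\<dots> \<longleftrightarrow> cross x v = 0"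
    unfolding quotient_metric_cross[OF assms assms(2,3)] using mass_pos
    by (simp add: complex_eq_iff sum_squares_eq_zero_iff)
  finally show ?thesis .
qed

lemma squared_sides_sum:
  assumes "x \<in> config_sphere m"
  shows "(cmod (x $ 2 - x $ 3))\<^sup>2 + (cmod (x $ 3 - x $ 1))\<^sup>2 + (cmod (x $ 1 - x $ 2))\<^sup>2 = 3 / \<mu>"
proof -
  have x3: "x $ 3 = - x $ 1 - x $ 2" and I: "mass_inner m x x = 1"
    using assms third_component unfolding config_sphere_iff by blast+
  have "\<mu> * ((cmod (x $ 2 - x $ 3))\<^sup>2 + (cmod (x $ 3 - x $ 1))\<^sup>2 + (cmod (x $ 1 - x $ 2))\<^sup>2)
      = 3 * mass_inner m x x"
    unfolding mass_inner_def sum_3 mass x3 cmod_power2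
    by (simp add: inner_complex_def power2_eq_square algebra_simps)
  then show ?thesis using I mass_pos by (simp add: field_simps)
qed

end

section \<open>The curvature in an arbitrary parametrization\<close>

text \<open>Three derivatives suffice for the curvature of the metric induced by a lift: the metric
contains first derivatives of the lift and the curvature second derivatives of the metric.\<close>

lemma Ck_on_3:
  assumes "smooth_on \<sigma> V" "q \<in> V"
  shows "\<sigma> differentiable (at q)" "partial i \<sigma> differentiable (at q)"
    "partial j (partial i \<sigma>) differentiable (at q)"
proof -
  have "Ck_on (Suc (Suc (Suc 0))) \<sigma> V" using assms unfolding smooth_on_def by blast
  then show "\<sigma> differentiable (at q)" "partial i \<sigma> differentiable (at q)"
    "partial j (partial i \<sigma>) differentiable (at q)"
    using assms(2) by auto
qed

lemma Ck_on_3_linear: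
  assumes V: "open V" and \<sigma>: "smooth_on \<sigma> V" and q: "q \<in> V" and L: "bounded_linear L"
  shows "(\<lambda>q. L (\<sigma> q)) differentiable (at q)"
    "partial i (\<lambda>q. L (\<sigma> q)) q = L (partial i \<sigma> q)"
    "partial i (\<lambda>q. L (\<sigma> q)) differentiable (at q)"
    "partial j (partial i (\<lambda>q. L (\<sigma> q))) differentiable (at q)"
proof -
  note C = Ck_on_3[OF \<sigma>]
  show "(\<lambda>q. L (\<sigma> q)) differentiable (at q)"
    using differentiable_bounded_linear[OF L C(1)[OF q]] .
  have 1: "partial i (\<lambda>q. L (\<sigma> q)) q = L (partial i \<sigma> q)" if "q \<in> V" for i q
    using partial_bounded_linear[OF L C(1)[OF that]] .
  then show "partial i (\<lambda>q. L (\<sigma> q)) q = L (partial i \<sigma> q)" using q .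
  show "partial i (\<lambda>q. L (\<sigma> q)) differentiable (at q)"
    using differentiable_cong_open[OF V q _ differentiable_bounded_linear[OF L C(2)[OF q]]] 1
    by metis
  have 2: "partial j (partial i (\<lambda>q. L (\<sigma> q))) q = L (partial j (partial i \<sigma>) q)" if "q \<in> V" for q
  proof -
    have "partial j (partial i (\<lambda>q. L (\<sigma> q))) q = partial j (\<lambda>q. L (partial i \<sigma> q)) q"
      using 1 by (intro partial_cong_open[OF V that])
    then show ?thesis using partial_bounded_linear[OF L C(2)[OF that]] by simp
  qed
  show "partial j (partial i (\<lambda>q. L (\<sigma> q))) differentiable (at q)"
    using differentiable_cong_open[OF V q _ differentiable_bounded_linear[OF L C(3)[OF q]]] 2
    by metis
qed

lemma frechet_derivative_partials:
  assumes "\<sigma> differentiable (at p)"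
  shows "frechet_derivative \<sigma> (at p) w = w $ 1 *\<^sub>R partial 1 \<sigma> p + w $ 2 *\<^sub>R partial 2 \<sigma> p"
proof -
  have "w = w $ 1 *\<^sub>R axis 1 1 + w $ 2 *\<^sub>R axis 2 1"
    by (simp add: vec_eq_iff forall_2 axis_def)
  then have "frechet_derivative \<sigma> (at p) w =
      frechet_derivative \<sigma> (at p) (w $ 1 *\<^sub>R axis 1 1 + w $ 2 *\<^sub>R axis 2 1)" by simp
  then show ?thesis
    using linear_frechet_derivative[OF assms] unfolding partial_def
    by (simp add: linear_add linear_cmul)
qed

lemma potential_cmod:
  "potential m x = m $ 2 * m $ 3 / (cmod (x $ 2 - x $ 3))\<^sup>2 + m $ 3 * m $ 1 / (cmod (x $ 3 - x $ 1))\<^sup>2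
    + m $ 1 * m $ 2 / (cmod (x $ 1 - x $ 2))\<^sup>2"
  unfolding potential_def dist_norm by simp

context equal_masses
begin

lemma partial_tangent:
  assumes V: "open V" "p \<in> V" and \<sigma>: "\<sigma> ` V \<subseteq> config_sphere m" and d: "\<sigma> differentiable (at p)"
  shows "partial i \<sigma> p $ 1 + partial i \<sigma> p $ 2 + partial i \<sigma> p $ 3 = 0"
    and "mass_inner m (partial i \<sigma> p) (\<sigma> p) = 0"
proof -
  have D: "(\<sigma> has_derivative frechet_derivative \<sigma> (at p)) (at p)"
    using d by (rule has_derivative_frechet)
  have D': "((\<lambda>q. \<sigma> q $ k) has_derivative (\<lambda>h. frechet_derivative \<sigma> (at p) h $ k)) (at p)" for k
    using bounded_linear.has_derivative[OF bounded_linear_vec_nth D] .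
  have on: "\<sigma> q $ 1 + \<sigma> q $ 2 + \<sigma> q $ 3 = 0" "mass_inner m (\<sigma> q) (\<sigma> q) = 1" if "q \<in> V" for q
    using that \<sigma> config_sphere_iff by blast+
  have "partial i (\<lambda>q. \<sigma> q $ 1 + \<sigma> q $ 2 + \<sigma> q $ 3) p = partial i (\<lambda>q. 0) p"
    using on by (intro partial_cong_open[OF V]) auto
  then show "partial i \<sigma> p $ 1 + partial i \<sigma> p $ 2 + partial i \<sigma> p $ 3 = 0"
    unfolding partial_unique[OF has_derivative_add[OF has_derivative_add[OF D'[of 1] D'[of 2]] D'[of 3]]]
    by (simp add: partial_def)
  have "partial i (\<lambda>q. mass_inner m (\<sigma> q) (\<sigma> q)) p = partial i (\<lambda>q. 1) p"
    using on by (intro partial_cong_open[OF V]) auto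
  moreover have "((\<lambda>q. mass_inner m (\<sigma> q) (\<sigma> q)) has_derivative
      (\<lambda>h. 2 * mass_inner m (frechet_derivative \<sigma> (at p) h) (\<sigma> p))) (at p)"
    unfolding mass_inner_def sum_3 using D'
    by (auto intro!: derivative_eq_intros simp: fun_eq_iff inner_commute algebra_simps)
  ultimately show "mass_inner m (partial i \<sigma> p) (\<sigma> p) = 0"
    using partial_unique by (fastforce simp: partial_def)
qed

lemma not_collision:
  assumes "x \<in> config_sphere m" "shape x \<in> pair_of_pants m"
  shows "x $ 2 - x $ 3 \<noteq> 0" "x $ 3 - x $ 1 \<noteq> 0" "x $ 1 - x $ 2 \<noteq> 0"
  using assms unfolding pair_of_pants_def collision_points_def by auto

definition jm_curvature :: "config \<Rightarrow> real" where
  "jm_curvature x = (let r = (cmod (x $ 2 - x $ 3))\<^sup>2; s = (cmod (x $ 3 - x $ 1))\<^sup>2;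
      t = (cmod (x $ 1 - x $ 2))\<^sup>2
    in - 6 * curvature_excess r s t / (\<mu> ^ 4 * (1 / r + 1 / s + 1 / t)))"

text \<open>The differences of positions along a lift form a family of triangles of constant size, with
\<open>wronskian a b = 3 cross \<sigma> (d\<sigma>)\<close>. The result mentions the parametrization only through the
side lengths, so no invariance of curvature under changes of coordinates has to be invoked.\<close>

lemma gauss_curvature_jm_metric:
  assumes par: "pants_parametrization m V \<sigma>" and p: "p \<in> V"
  shows "gauss_curvature (jm_metric m \<sigma>) p = jm_curvature (\<sigma> p)"
proof -
  have V: "open V" and sm: "smooth_on \<sigma> V" and sph: "\<sigma> ` V \<subseteq> config_sphere m"
    and pants: "\<And>q. q \<in> V \<Longrightarrow> shape (\<sigma> q) \<in> pair_of_pants m"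
    and imm: "\<And>q w. q \<in> V \<Longrightarrow> horizontal_part m (\<sigma> q) (frechet_derivative \<sigma> (at q) w) = 0 \<Longrightarrow> w = 0"
    using par unfolding pants_parametrization_def by auto
  have sphq: "\<sigma> q \<in> config_sphere m" if "q \<in> V" for q using sph that by blast
  define a where "a q = \<sigma> q $ 2 - \<sigma> q $ 3" for q
  define b where "b q = \<sigma> q $ 3 - \<sigma> q $ 1" for q
  have La: "bounded_linear (\<lambda>x::config. x $ 2 - x $ 3)" and Lb: "bounded_linear (\<lambda>x::config. x $ 3 - x $ 1)"
    by (intro bounded_linear_sub bounded_linear_vec_nth)+
  note a = Ck_on_3_linear[OF V sm _ La, folded a_def[abs_def]]
  note b = Ck_on_3_linear[OF V sm _ Lb, folded b_def[abs_def]]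
  have ab: "a q + b q = - (\<sigma> q $ 1 - \<sigma> q $ 2)" for q unfolding a_def b_def by simp
  note C = Ck_on_3[OF sm]
  note tan = partial_tangent[OF V _ sph C(1)]
  define \<theta> where "\<theta> i q = cross (\<sigma> q) (partial i \<sigma> q)" for i q
  have wr: "wronskian a b i q = 3 * \<theta> i q" if "q \<in> V" for i q
  proof -
    have third: "\<sigma> q $ 3 = - \<sigma> q $ 1 - \<sigma> q $ 2"
      "partial i \<sigma> q $ 3 = - partial i \<sigma> q $ 1 - partial i \<sigma> q $ 2"
      using sphq[OF that] tan(1)[OF that that, of i] third_component
      unfolding config_sphere_iff by blast+
    show ?thesis
      unfolding wronskian_def a(2)[OF that] b(2)[OF that] a_def b_def \<theta>_def cross_def third
      by (simp add: algebra_simps)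
  qed
  have Im: "Im (cnj (\<theta> 1 q) * \<theta> 2 q) \<noteq> 0" if q: "q \<in> V" for q
  proof
    assume 0: "Im (cnj (\<theta> 1 q) * \<theta> 2 q) = 0"
    have zero: "w = 0" if "w $ 1 *\<^sub>R \<theta> 1 q + w $ 2 *\<^sub>R \<theta> 2 q = 0" for w :: "real^2"
    proof -
      let ?v = "w $ 1 *\<^sub>R partial 1 \<sigma> q + w $ 2 *\<^sub>R partial 2 \<sigma> q"
      have fd: "frechet_derivative \<sigma> (at q) w = ?v"
        using frechet_derivative_partials[OF C(1)[OF q]] .
      have "?v $ 1 + ?v $ 2 + ?v $ 3 =
          w $ 1 *\<^sub>R (partial 1 \<sigma> q $ 1 + partial 1 \<sigma> q $ 2 + partial 1 \<sigma> q $ 3)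
        + w $ 2 *\<^sub>R (partial 2 \<sigma> q $ 1 + partial 2 \<sigma> q $ 2 + partial 2 \<sigma> q $ 3)"
        by (simp add: scaleR_add_right)
      then have "?v $ 1 + ?v $ 2 + ?v $ 3 = 0" unfolding tan(1)[OF q q] by simp
      moreover have "mass_inner m ?v (\<sigma> q) = 0"
        unfolding mass_inner_bilinear tan(2)[OF q q] by simp
      moreover have "cross (\<sigma> q) ?v = 0"
        using that unfolding cross_linear \<theta>_def .
      ultimately have "horizontal_part m (\<sigma> q) (frechet_derivative \<sigma> (at q) w) = 0"
        unfolding fd using horizontal_part_eq_0_iff[OF sphq[OF q]] by blast
      then show "w = 0" using imm[OF q] by blast
    qed
    show False
    proof (cases "\<theta> 1 q = 0")
      case True
      then show False using zero[of "axis 1 1"] by (simp add: axis_def vec_eq_iff forall_2)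
    next
      case False
      \<comment> \<open>As \<open>cnj (\<theta> 1 q) * \<theta> 2 q\<close> is real, \<open>\<theta> 1 q\<close> and \<open>\<theta> 2 q\<close> are real multiples of each other; this is the relation with the denominators cleared.\<close>
      let ?w = "vector [Re (cnj (\<theta> 1 q) * \<theta> 2 q), - (cmod (\<theta> 1 q))\<^sup>2] :: real^2"
      have "cnj (\<theta> 1 q) * \<theta> 2 q = complex_of_real (Re (cnj (\<theta> 1 q) * \<theta> 2 q))"
        using 0 by (simp add: complex_eq_iff del: times_complex.sel)
      then have "complex_of_real (Re (cnj (\<theta> 1 q) * \<theta> 2 q)) * \<theta> 1 q
          = complex_of_real ((cmod (\<theta> 1 q))\<^sup>2) * \<theta> 2 q"
        unfolding complex_norm_square by (metis mult.assoc mult.commute)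
      then have "?w $ 1 *\<^sub>R \<theta> 1 q + ?w $ 2 *\<^sub>R \<theta> 2 q = 0"
        by (simp add: scaleR_conv_of_real del: times_complex.sel of_real_power)
      then have "?w $ 2 = 0" using zero by (metis zero_index)
      then show False using False by simp
    qed
  qed
  interpret triangle_family V a b "3 / \<mu>"
  proof
    fix q assume q: "q \<in> V"
    show "a q \<noteq> 0" "b q \<noteq> 0" "a q + b q \<noteq> 0"
      using not_collision[OF sphq[OF q] pants[OF q]] unfolding ab unfolding a_def b_def by auto
    show "(cmod (a q))\<^sup>2 + (cmod (b q))\<^sup>2 + (cmod (a q + b q))\<^sup>2 = 3 / \<mu>"
      using squared_sides_sum[OF sphq[OF q]] unfolding ab norm_minus_cancel unfolding a_def b_def .
    show "Im (cnj (wronskian a b 1 q) * wronskian a b 2 q) \<noteq> 0"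
      using Im[OF q] unfolding wr[OF q] by simp
  qed (use V a b in auto)
  have met: "jm_metric m \<sigma> q $ i $ j
      = \<mu> ^ 4 / 3 * inverse_square_sum q * Re (cnj (wronskian a b i q) * wronskian a b j q)" if q: "q \<in> V" for i j q
  proof -
    have "potential m (\<sigma> q) = \<mu>\<^sup>2 * inverse_square_sum q"
      unfolding potential_cmod inverse_square_sum_def ab norm_minus_cancel mass
      unfolding a_def b_def by (simp add: power2_eq_square algebra_simps)
    moreover have "quotient_metric m (\<sigma> q) (partial i \<sigma> q) (partial j \<sigma> q)
        = 3 * \<mu>\<^sup>2 * Re (cnj (\<theta> i q) * \<theta> j q)"
      using quotient_metric_cross[OF sphq[OF q] tan(1)[OF q q] tan(2)[OF q q] tan(1)[OF q q] tan(2)[OF q q]]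
      unfolding \<theta>_def .
    moreover have "Re (cnj (3 * \<theta> i q) * (3 * \<theta> j q)) = 9 * Re (cnj (\<theta> i q) * \<theta> j q)"
      by simp
    ultimately show ?thesis
      unfolding jm_metric_def wr[OF q]
      by (simp add: power2_eq_square power4_eq_xxxx del: times_complex.sel)
  qed
  have "gauss_curvature (jm_metric m \<sigma>) p = - 2 * excess p / (\<mu> ^ 4 / 3 * inverse_square_sum p)"
    using triangle_curvature[OF _ met p] mass_pos by simp
  moreover have "excess p = curvature_excess ((cmod (a p))\<^sup>2) ((cmod (b p))\<^sup>2) ((cmod (a p + b p))\<^sup>2)"
    unfolding excess_def curvature_excess_def inverse_square_sum_def size[OF p] ..
  ultimately show ?thesis
    unfolding jm_curvature_def Let_def inverse_square_sum_def ab norm_minus_cancel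
    unfolding a_def b_def by (simp add: field_simps)
qed

end

section \<open>Closure properties of smooth functions\<close>

lemma Ck_on_cong:
  assumes "open V" "\<And>p. p \<in> V \<Longrightarrow> f p = g p" "Ck_on k f V"
  shows "Ck_on k g V"
  using assms(2,3)
proof (induction k arbitrary: f g)
  case 0
  then show ?case using continuous_on_cong[of V V f g] by simp
next
  case (Suc k)
  have "g differentiable (at p)" if "p \<in> V" for p
    using differentiable_cong_open[OF assms(1) that Suc.prems(1)] Suc.prems(2) that by simp
  moreover have "Ck_on k (partial i g) V" for i
    using Suc.IH[of "partial i f" "partial i g"] partial_cong_open[OF assms(1) _ Suc.prems(1)]
      Suc.prems(2) by simp
  ultimately show ?case by simp
qed

lemma Ck_on_Suc:
  assumes "Ck_on (Suc k) f V"
  shows "Ck_on k f V"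
  using assms
proof (induction k arbitrary: f)
  case 0
  then show ?case
    by (simp add: continuous_at_imp_continuous_on differentiable_imp_continuous_within)
qed simp

lemma Ck_on_const: "Ck_on k (\<lambda>p. c) V"
  by (induction k arbitrary: c) (simp_all add: partial_def[abs_def] frechet_derivative_const)

lemma Ck_on_affine:
  assumes "bounded_linear L"
  shows "Ck_on k (\<lambda>p. c + L p) V"
proof -
  have d: "((\<lambda>p. c + L p) has_derivative L) (at p)" for p
    using has_derivative_add[OF has_derivative_const bounded_linear_imp_has_derivative[OF assms]] by simp
  then have "partial i (\<lambda>p. c + L p) = (\<lambda>p. L (axis i 1))" for i
    using partial_unique by blast
  moreover have "continuous_on V (\<lambda>p. c + L p)"
    using assms by (intro continuous_intros linear_continuous_on)
  moreover have "(\<lambda>p. c + L p) differentiable (at p)" for p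
    using d by (rule differentiableI)
  ultimately show ?thesis
    by (cases k) (simp_all add: Ck_on_const)
qed

lemma Ck_on_add:
  assumes "open V" "Ck_on k f V" "Ck_on k g V"
  shows "Ck_on k (\<lambda>p. f p + g p) V"
  using assms(2,3)
proof (induction k arbitrary: f g)
  case 0
  then show ?case by (simp add: continuous_on_add)
next
  case (Suc k)
  have "Ck_on k (partial i (\<lambda>p. f p + g p)) V" for i
  proof (rule Ck_on_cong[OF assms(1)])
    show "Ck_on k (\<lambda>p. partial i f p + partial i g p) V"
      using Suc.prems by (intro Suc.IH) simp_all
    show "partial i f p + partial i g p = partial i (\<lambda>p. f p + g p) p" if "p \<in> V" for p
      using Suc.prems that by (simp add: partial_add)
  qed
  then show ?case using Suc.prems by simp
qed

lemma Ck_on_scaleR: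
  assumes "open V" "Ck_on k f V" "Ck_on k g V"
  shows "Ck_on k (\<lambda>p. f p *\<^sub>R g p) V"
  using assms(2,3)
proof (induction k arbitrary: f g)
  case 0
  then show ?case by (simp add: continuous_on_scaleR)
next
  case (Suc k)
  have "Ck_on k (partial i (\<lambda>p. f p *\<^sub>R g p)) V" for i
  proof (rule Ck_on_cong[OF assms(1)])
    show "Ck_on k (\<lambda>p. f p *\<^sub>R partial i g p + partial i f p *\<^sub>R g p) V"
      using Suc.prems Suc.prems[THEN Ck_on_Suc] by (intro Ck_on_add[OF assms(1)] Suc.IH) simp_all
    show "f p *\<^sub>R partial i g p + partial i f p *\<^sub>R g p = partial i (\<lambda>p. f p *\<^sub>R g p) p" if "p \<in> V" for p
      using Suc.prems that by (simp add: partial_scaleR)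
  qed
  then show ?case using Suc.prems by (simp add: differentiable_scaleR)
qed

section \<open>A parametrization around every shape\<close>

text \<open>It brings the configurations \<open>x + displacement x p\<close> below to unit size. The
factor \<open>3\<close> is the squared size of the direction of displacement.\<close>

definition normalizing_factor :: "real^2 \<Rightarrow> real" where
  "normalizing_factor p = 1 / sqrt (1 + 3 * (p \<bullet> p))"

lemma normalizing_factor_pos: "normalizing_factor p > 0"
  unfolding normalizing_factor_def using inner_ge_zero[of p] by (simp add: add_pos_nonneg)

lemma normalizing_factor_square: "(normalizing_factor p)\<^sup>2 * (1 + 3 * (p \<bullet> p)) = 1"
proof -
  have "1 + 3 * (p \<bullet> p) > 0" using inner_ge_zero[of p] by (simp add: add_pos_nonneg)
  then show ?thesis unfolding normalizing_factor_def by (simp add: power_divide)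
qed

lemma has_derivative_normalizing_factor:
  "(normalizing_factor has_derivative (\<lambda>h. - (3 * (p \<bullet> h) * (normalizing_factor p * normalizing_factor p * normalizing_factor p)))) (at p)"
proof -
  let ?n = "1 + 3 * (p \<bullet> p)"
  have n: "?n > 0" using inner_ge_zero[of p] by (simp add: add_pos_nonneg)
  have sq: "sqrt ?n * sqrt ?n = ?n" using n by simp
  have "((\<lambda>p. 1 + 3 * (p \<bullet> p)) has_derivative (\<lambda>h. 6 * (p \<bullet> h))) (at p)"
    by (auto intro!: derivative_eq_intros simp: fun_eq_iff inner_commute)
  moreover have "((\<lambda>n. 1 / sqrt n) has_real_derivative
      - (1 / 2 * (1 / sqrt ?n * (1 / sqrt ?n) * (1 / sqrt ?n)))) (at ?n)"
    using n sq by (auto intro!: derivative_eq_intros simp: divide_simps)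
  ultimately have "((\<lambda>p. 1 / sqrt (1 + 3 * (p \<bullet> p))) has_derivative
      (\<lambda>h. - (1 / 2 * (1 / sqrt ?n * (1 / sqrt ?n) * (1 / sqrt ?n))) * (6 * (p \<bullet> h)))) (at p)"
    unfolding has_field_derivative_def using has_derivative_compose[of "\<lambda>p. 1 + 3 * (p \<bullet> p)"] by blast
  then show ?thesis
    unfolding normalizing_factor_def[abs_def] by (rule back_subst) (simp add: fun_eq_iff)
qed

text \<open>The partial derivatives of the factor are polynomials in the coordinates and the factor
itself, so differentiability reproduces itself.\<close>

lemma Ck_on_normalizing_factor:
  assumes "open V"
  shows "Ck_on k normalizing_factor V"
proof (induction k)
  case 0
  show ?case
    using has_derivative_continuous[OF has_derivative_normalizing_factor] continuous_at_imp_continuous_on by auto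
next
  case (Suc k)
  have "partial i normalizing_factor = (\<lambda>p. (0 + (-3) * p $ i) *\<^sub>R (normalizing_factor p *\<^sub>R (normalizing_factor p *\<^sub>R normalizing_factor p)))" for i
    using partial_unique[OF has_derivative_normalizing_factor] by (simp add: fun_eq_iff inner_axis)
  moreover have "bounded_linear (\<lambda>p::real^2. (-3) * p $ i)" for i
    by (intro bounded_linear_mult_right[THEN bounded_linear_compose] bounded_linear_vec_nth)
  ultimately have "Ck_on k (partial i normalizing_factor) V" for i
    using Suc.IH by (simp only:) (intro Ck_on_scaleR assms Ck_on_affine)
  moreover have "normalizing_factor differentiable (at p)" for p
    using has_derivative_normalizing_factor by (rule differentiableI)
  ultimately show ?case by simp
qed

lemma rotate_config_cross: "cross x (rotate_config t x) = 0"
  unfolding cross_def rotate_config_def by simp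

lemma dist_rotate_config:
  "cmod (rotate_config t x $ i - rotate_config t x $ j) = cmod (x $ i - x $ j)"
  unfolding rotate_config_def by (simp add: norm_mult flip: right_diff_distrib)

lemma shape_refl: "x \<in> shape x"
  unfolding shape_def by (rule image_eqI[of _ _ 0]) (simp_all add: rotate_config_def vec_eq_iff)

lemma shape_eq_imp_dist:
  assumes "x \<in> shape y"
  shows "cmod (x $ i - x $ j) = cmod (y $ i - y $ j)"
  using assms dist_rotate_config unfolding shape_def by auto

text \<open>The complex conjugates of the sides of \<open>x\<close>. They sum to zero, and they are orthogonal to
\<open>x\<close> for the Hermitian form of equal masses because the sum of \<open>x\<^sub>j (x\<^sub>j\<^sub>+\<^sub>1 - x\<^sub>j\<^sub>+\<^sub>2)\<close> over the cyclic
indices vanishes. Together with \<open>x \<noteq> 0\<close> they span the plane of centred configurations.\<close>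

definition orthogonal_config :: "config \<Rightarrow> config" where
  "orthogonal_config x = (\<chi> j. cnj (if j = 1 then x $ 2 - x $ 3 else if j = 2 then x $ 3 - x $ 1 else x $ 1 - x $ 2))"

text \<open>Complex multiples of \<open>orthogonal_config x\<close>, with the pair \<open>p\<close> read as a complex number.\<close>

definition displacement :: "config \<Rightarrow> real^2 \<Rightarrow> config" where
  "displacement x p = p $ 1 *\<^sub>R orthogonal_config x + p $ 2 *\<^sub>R vertical (orthogonal_config x)"

lemma bounded_linear_displacement: "bounded_linear (displacement x)"
  unfolding displacement_def[abs_def]
  by (intro bounded_linear_add bounded_linear_scaleR_const bounded_linear_vec_nth)

lemma orthogonal_config_nth:
  "orthogonal_config x $ 1 = cnj (x $ 2 - x $ 3)" "orthogonal_config x $ 2 = cnj (x $ 3 - x $ 1)"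
  "orthogonal_config x $ 3 = cnj (x $ 1 - x $ 2)"
  unfolding orthogonal_config_def by simp_all

lemma cross_displacement:
  "cross x (displacement x p) = Complex (p $ 1) (p $ 2) * cross x (orthogonal_config x)"
  "cross (displacement x q) (displacement x p) = 0"
  unfolding displacement_def cross_def vertical_def
  by (simp_all add: complex_eq_iff algebra_simps)

lemma cross_commute: "cross x y = - cross y x"
  unfolding cross_def by simp

context equal_masses
begin

lemma cross_orthogonal_config:
  assumes "x \<in> config_sphere m"
  shows "cross x (orthogonal_config x) \<noteq> 0"
proof
  have third: "x $ 3 = - x $ 1 - x $ 2" and I: "mass_inner m x x = 1"
    using assms third_component unfolding config_sphere_iff by blast+
  assume 0: "cross x (orthogonal_config x) = 0"
  have "mass_inner m x x = - \<mu> * Re (cross x (orthogonal_config x))"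
    unfolding cross_def orthogonal_config_nth mass_inner_def sum_3 mass third
    by (simp add: inner_complex_def algebra_simps)
  then show False using 0 I by simp
qed

lemma displacement_sphere:
  assumes "x \<in> config_sphere m"
  shows "normalizing_factor p *\<^sub>R (x + displacement x p) \<in> config_sphere m"
proof -
  have third: "x $ 3 = - x $ 1 - x $ 2" and I: "mass_inner m x x = 1"
    using assms third_component unfolding config_sphere_iff by blast+
  let ?d = "displacement x p"
  have "x $ 1 + ?d $ 1 + (x $ 2 + ?d $ 2) + (x $ 3 + ?d $ 3) = 0"
    unfolding displacement_def vertical_def third
    by (simp add: orthogonal_config_nth third complex_eq_iff algebra_simps)
  then have c: "(normalizing_factor p *\<^sub>R (x + ?d)) $ 1 + (normalizing_factor p *\<^sub>R (x + ?d)) $ 2 + (normalizing_factor p *\<^sub>R (x + ?d)) $ 3 = 0"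
    by (simp flip: scaleR_add_right)
  have 1: "mass_inner m x (orthogonal_config x) = 0" "mass_inner m x (vertical (orthogonal_config x)) = 0"
    unfolding mass_inner_def sum_3 mass vertical_def vec_lambda_beta orthogonal_config_nth third
    by (simp_all add: inner_complex_def algebra_simps)
  have 2: "mass_inner m (orthogonal_config x) (orthogonal_config x) = 3"
  proof -
    have "mass_inner m (orthogonal_config x) (orthogonal_config x) = 3 * mass_inner m x x"
      unfolding mass_inner_def sum_3 mass vertical_def vec_lambda_beta orthogonal_config_nth third
      by (simp add: inner_complex_def algebra_simps)
    then show ?thesis using I by simp
  qed
  have 3: "mass_inner m y (vertical y) = 0" for y
    unfolding mass_inner_def sum_3 mass vertical_def by (simp add: inner_complex_def)
  have "mass_inner m (x + ?d) (x + ?d) = 1 + 3 * (p \<bullet> p)"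
    unfolding displacement_def mass_inner_bilinear mass_inner_vertical
    by (simp add: 1 2 3 I mass_inner_commute[of m "orthogonal_config x" x]
        mass_inner_commute[of m "vertical _"] inner_vec_def sum_2)
  then have "mass_inner m (normalizing_factor p *\<^sub>R (x + ?d)) (normalizing_factor p *\<^sub>R (x + ?d)) = 1"
    using normalizing_factor_square[of p] by (simp add: mass_inner_bilinear(5,6) power2_eq_square mult.assoc)
  then show ?thesis using c unfolding config_sphere_iff by blast
qed

text \<open>The affine chart \<open>w \<mapsto> [x + w x']\<close> of the complex projective line, lifted to the three-sphere,
where \<open>x'\<close> is orthogonal to \<open>x\<close>; it is centred at the given shape, so that every shape is
covered by the same construction. Both injectivity and
the rank condition can be read off from \<open>cross\<close>, which detects complex multiples.\<close>

lemma parametrization_exists: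
  assumes x: "x \<in> config_sphere m" and pants: "shape x \<in> pair_of_pants m"
  shows "\<exists>V \<sigma>. pants_parametrization m V \<sigma> \<and> shape x \<in> (shape \<circ> \<sigma>) ` V"
proof -
  define \<tau> where "\<tau> p = x + displacement x p" for p
  define \<sigma> where "\<sigma> p = normalizing_factor p *\<^sub>R \<tau> p" for p
  define V where "V = {p. \<tau> p $ 1 \<noteq> \<tau> p $ 2} \<inter> {p. \<tau> p $ 2 \<noteq> \<tau> p $ 3} \<inter> {p. \<tau> p $ 3 \<noteq> \<tau> p $ 1}"
  let ?w = "\<lambda>p::real^2. Complex (p $ 1) (p $ 2)"
  let ?c = "cross x (orthogonal_config x)"
  have cont: "continuous_on UNIV (\<lambda>p. \<tau> p $ i)" for i
    unfolding \<tau>_def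
    by (intro continuous_intros linear_continuous_on bounded_linear_displacement)
  have V: "open V"
    unfolding V_def using cont by (intro open_Int open_Collect_neq) auto
  have cross_\<tau>: "cross (\<tau> p) (\<tau> q) = (?w q - ?w p) * ?c" for p q
    unfolding \<tau>_def cross_linear cross_displacement cross_commute[of "displacement x p" x]
    by (simp add: algebra_simps)
  have cross_\<tau>d: "cross (\<tau> p) (displacement x h) = ?w h * ?c" for p h
    unfolding \<tau>_def cross_linear cross_displacement by simp
  have sph: "\<sigma> p \<in> config_sphere m" for p
    unfolding \<sigma>_def \<tau>_def using displacement_sphere[OF x] .
  have sm: "smooth_on \<sigma> V"
    unfolding smooth_on_def \<sigma>_def \<tau>_def
    by (intro allI Ck_on_scaleR Ck_on_normalizing_factor Ck_on_affine V bounded_linear_displacement)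
  have "shape (\<sigma> p) \<in> pair_of_pants m" if "p \<in> V" for p
  proof -
    have "shape (\<sigma> p) \<notin> collision_points m"
    proof
      assume "shape (\<sigma> p) \<in> collision_points m"
      then obtain y where y: "y $ 1 = y $ 2 \<or> y $ 2 = y $ 3 \<or> y $ 3 = y $ 1" "shape (\<sigma> p) = shape y"
        unfolding collision_points_def by auto
      have "\<sigma> p \<in> shape y" using y(2) shape_refl by blast
      then have eq: "cmod (\<sigma> p $ i - \<sigma> p $ j) = cmod (y $ i - y $ j)" for i j
        by (rule shape_eq_imp_dist)
      have "\<sigma> p $ 1 = \<sigma> p $ 2 \<or> \<sigma> p $ 2 = \<sigma> p $ 3 \<or> \<sigma> p $ 3 = \<sigma> p $ 1"
        using y(1) eq[of 1 2] eq[of 2 3] eq[of 3 1] by auto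
      then show False
        using that normalizing_factor_pos[of p] unfolding V_def \<sigma>_def by auto
    qed
    then show ?thesis using sph unfolding pair_of_pants_def shape_sphere_def by blast
  qed
  moreover have "inj_on (shape \<circ> \<sigma>) V"
  proof (rule inj_onI)
    fix p q assume "(shape \<circ> \<sigma>) p = (shape \<circ> \<sigma>) q"
    then have "\<sigma> q \<in> shape (\<sigma> p)" using shape_refl by force
    then have "cross (\<sigma> p) (\<sigma> q) = 0" using rotate_config_cross unfolding shape_def by auto
    then have "cross (\<tau> p) (\<tau> q) = 0"
      using normalizing_factor_pos[of p] normalizing_factor_pos[of q] unfolding \<sigma>_def cross_linear by auto
    then have "?w q = ?w p"
      using cross_orthogonal_config[OF x] unfolding cross_\<tau> by simp
    then show "p = q" by (simp add: vec_eq_iff forall_2)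
  qed
  moreover have "h = 0" if hor: "horizontal_part m (\<sigma> p) (frechet_derivative \<sigma> (at p) h) = 0" for p h
  proof -
    obtain r where r: "frechet_derivative \<sigma> (at p) h = r *\<^sub>R vertical (\<sigma> p)"
      using hor unfolding horizontal_part_def by auto
    have "(\<tau> has_derivative displacement x) (at p)"
      unfolding \<tau>_def[abs_def] using has_derivative_add[OF has_derivative_const
          bounded_linear_imp_has_derivative[OF bounded_linear_displacement]] by fastforce
    note der = has_derivative_scaleR[OF has_derivative_normalizing_factor this, folded \<sigma>_def]
    obtain c where c: "frechet_derivative \<sigma> (at p) h = normalizing_factor p *\<^sub>R displacement x h + c *\<^sub>R \<tau> p"
      using fun_cong[OF frechet_derivative_at[OF der], of h] by (metis (no_types))
    have "cross (\<sigma> p) (frechet_derivative \<sigma> (at p) h) = 0"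
      unfolding r cross_linear by simp
    then have "normalizing_factor p *\<^sub>R (normalizing_factor p *\<^sub>R (?w h * ?c)) = 0"
      unfolding c \<sigma>_def cross_linear cross_\<tau>d by simp
    then have "?w h = 0"
      using normalizing_factor_pos[of p] cross_orthogonal_config[OF x] by simp
    then show "h = 0" by (simp add: vec_eq_iff forall_2 complex_eq_iff)
  qed
  ultimately have "pants_parametrization m V \<sigma>"
    unfolding pants_parametrization_def using V sm sph by (simp add: image_subset_iff)
  moreover have "\<sigma> 0 = x"
    unfolding \<sigma>_def \<tau>_def normalizing_factor_def displacement_def by simp
  moreover have "0 \<in> V"
    using not_collision[OF x pants] unfolding V_def \<tau>_def displacement_def by auto
  ultimately show ?thesis by force
qed

section \<open>The curvature of the pair of pants\<close>

lemma jm_curvature_shape: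
  assumes "x \<in> shape y"
  shows "jm_curvature x = jm_curvature y"
  unfolding jm_curvature_def shape_eq_imp_dist[OF assms] ..

lemma has_jm_curvature_shape:
  assumes x: "x \<in> config_sphere m" and pants: "shape x \<in> pair_of_pants m"
  shows "has_jm_curvature m (shape x) (jm_curvature x)"
  unfolding has_jm_curvature_def
proof (intro conjI allI impI)
  show "\<exists>V \<sigma>. pants_parametrization m V \<sigma> \<and> shape x \<in> (shape \<circ> \<sigma>) ` V"
    using parametrization_exists[OF assms] .
  fix V \<sigma> p assume *: "pants_parametrization m V \<sigma> \<and> p \<in> V \<and> shape (\<sigma> p) = shape x"
  then have "\<sigma> p \<in> shape x" using shape_refl by blast
  then show "gauss_curvature (jm_metric m \<sigma>) p = jm_curvature x"
    using gauss_curvature_jm_metric * jm_curvature_shape by metis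
qed

lemma jm_curvature_sign:
  assumes x: "x \<in> config_sphere m" and pants: "shape x \<in> pair_of_pants m"
  shows "shape x \<in> lagrange_points m \<Longrightarrow> jm_curvature x = 0"
    and "shape x \<notin> lagrange_points m \<Longrightarrow> jm_curvature x < 0"
proof -
  let ?r = "cmod (x $ 2 - x $ 3)" and ?s = "cmod (x $ 3 - x $ 1)" and ?t = "cmod (x $ 1 - x $ 2)"
  have pos: "?r > 0" "?s > 0" "?t > 0" using not_collision[OF assms] by simp_all
  have lag: "shape x \<in> lagrange_points m \<longleftrightarrow> ?r = ?s \<and> ?s = ?t"
  proof -
    have "(\<exists>y\<in>shape x. cmod (y $ 1 - y $ 2) = cmod (y $ 2 - y $ 3) \<and>
        cmod (y $ 2 - y $ 3) = cmod (y $ 3 - y $ 1)) \<longleftrightarrow> ?t = ?r \<and> ?r = ?s"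
      using shape_eq_imp_dist[of _ x] shape_refl[of x] by metis
    then show ?thesis using pants unfolding lagrange_points_def dist_norm by auto
  qed
  show "jm_curvature x = 0" if "shape x \<in> lagrange_points m"
    using that pos curvature_excess_equilateral[of "?t\<^sup>2"] unfolding lag jm_curvature_def by simp
  assume "shape x \<notin> lagrange_points m"
  then have "\<not> (?r\<^sup>2 = ?s\<^sup>2 \<and> ?s\<^sup>2 = ?t\<^sup>2)"
    unfolding lag by simp
  then have "curvature_excess (?r\<^sup>2) (?s\<^sup>2) (?t\<^sup>2) > 0"
    using curvature_excess_pos pos by simp
  moreover have "\<mu> ^ 4 * (1 / ?r\<^sup>2 + 1 / ?s\<^sup>2 + 1 / ?t\<^sup>2) > 0"
    using pos mass_pos by (simp add: add_pos_pos)
  ultimately show "jm_curvature x < 0"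
    unfolding jm_curvature_def Let_def by (simp add: divide_neg_pos)
qed

end

theorem theorem1:
  fixes m :: "real^3"
  assumes "\<And>i. m $ i > 0"
    and "m $ 1 = m $ 2" and "m $ 2 = m $ 3"
  shows "(\<forall>q \<in> pair_of_pants m - lagrange_points m. \<exists>K < 0. has_jm_curvature m q K) \<and>
         (\<forall>q \<in> lagrange_points m. has_jm_curvature m q 0)"
proof -
  have "m $ i = m $ 1" for i
    using assms(2,3) exhaust_3[of i] by auto
  then interpret equal_masses m "m $ 1"
    using assms(1) by unfold_locales
  have rep: "\<exists>x \<in> config_sphere m. q = shape x" if "q \<in> pair_of_pants m" for q
    using that unfolding pair_of_pants_def shape_sphere_def by auto
  have "lagrange_points m \<subseteq> pair_of_pants m"
    unfolding lagrange_points_def by auto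
  then have "has_jm_curvature m q 0" if "q \<in> lagrange_points m" for q
    using that rep[of q] has_jm_curvature_shape jm_curvature_sign(1) by fastforce
  moreover have "\<exists>K < 0. has_jm_curvature m q K" if "q \<in> pair_of_pants m - lagrange_points m" for q
    using that rep[of q] has_jm_curvature_shape jm_curvature_sign(2) by blast
  ultimately show ?thesis by blast
qed

end
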